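(* Let $\mathbf{V}$ be a variety of algebras in a countable language which satisfies the Reinforced Construction Principle $(\mathrm{RCP})$, and let $(\mathcal{K},\preccurlyeq)$ be a strong enough $\mathrm{AEC}$-covering of $(\mathcal{F}_{\mathbf{V}},\leq_{\ast}^{\mathrm{ff}})$. Then $(\mathcal{K},\preccurlyeq)$ is not superstable, i.e., it is not the case that $(\mathcal{K},\preccurlyeq)$ is $\lambda$-stable for all $\lambda$ in a tail of cardinals.
   Context: Free objects. Let $\mathbf{V}$ be a variety of algebras (in the sense of universal algebra) in a language $L$. $\mathcal{F}_{\mathbf{V}}$ is the class of free algebras in $\mathbf{V}$, and $\mathcal{F}^{\infty}_{\mathbf{V}}$ the class of those of infinite rank. $\ast$ denotes the free product (coproduct) in $\mathbf{V}$. $A\leq B$ means that $A$ is an $L$-substructure of $B$, and $\langle X\rangle_B$ is the substructure of $B$ generated by $X$. For $A,B\in\mathcal{F}_{\mathbf{V}}$, $A\leq_{\ast}^{\mathrm{ff}} B$ means that there is $C\in\mathcal{F}_{\mathbf{V}}$ with $A\ast C=B$ (i.e., $A,C\leq B$ and $B$ is the internal free product of $A$ and $C$). For a structure $B$ and $C\subseteq B$, $\mathrm{dcl}^{\mathrm{qf}}_B(C)$ is the quantifier-free definable closure of $C$ in $B$: the set of $b\in B$ that are the unique solution in $B$ of some quantifier-free formula with parameters in $C$. RCP. $\mathbf{V}$ (in a countable language) satisfies $(\mathrm{RCP})$ if there are countable $A,B\in\mathcal{F}^{\infty}_{\mathbf{V}}$ with $A\leq B$ such that: (a) $A$ is freely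 generated by $\{a_i:i<\omega\}$ and, for every $i<\omega$, letting $A_i=\langle a_j:j\leq i\rangle_B$, we have $A_i\leq_{\ast}^{\mathrm{ff}}B$; (b) $A\not\leq_{\ast}^{\mathrm{ff}}B\ast C$ for every $C\in\mathcal{F}_{\mathbf{V}}$; (c) $B$ is freely generated by $\{b_i:i<\omega\}$ and $\mathrm{dcl}^{\mathrm{qf}}_B(A b_0)=B$. AECs. A class $\mathcal{K}$ of $L$-structures with a binary relation $\preccurlyeq$ is an abstract elementary class (AEC) if: (1) $\mathcal{K}$ and $\preccurlyeq$ are closed under isomorphism; (2) $A\preccurlyeq B$ implies $A\leq B$; (3) $\preccurlyeq$ is a partial order on $\mathcal{K}$; (4) if $(A_i)_{i<\delta}$ is an increasing continuous $\preccurlyeq$-chain in $\mathcal{K}$, then $\bigcup_{i<\delta}A_i\in\mathcal{K}$, $A_j\preccurlyeq\bigcup_{i<\delta}A_i$ for each $j<\delta$, and if $A_i\preccurlyeq B$ for all $i<\delta$ then $\bigcup_{i<\delta}A_i\preccurlyeq B$; (5) if $A,B,C\in\mathcal{K}$, $A\preccurlyeq C$, $B\preccurlyeq C$ and $A\leq B$, then $A\preccurlyeq B$; (6) there is a cardinal $\mathrm{LS}(\mathcal{K},\preccurlyeq)\geq|L|+\aleph_0$ such that if $A\in\mathcal{K}$ and $B\subseteq A$, there is $C\in\mathcal{K}$ with $B\subseteq C\preccurlyeq A$ and $|C|\leq|B|+\mathrm{LS}(\mathcal{K},\preccurlyeq)$. An embedding $f:A\to B$ is strong if $f(A)\preccurlyeq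 B$. AP and JEP are the amalgamation and joint embedding properties with respect to strong embeddings. AEC-covering. $(\mathcal{K},\preccurlyeq)$ is an $\mathrm{AEC}$-covering of $(\mathcal{F}_{\mathbf{V}},\leq_{\ast}^{\mathrm{ff}})$ if: $\mathcal{F}^{\infty}_{\mathbf{V}}\subseteq\mathcal{K}$; $(\mathcal{K},\preccurlyeq)$ is an AEC; for $A,B\in\mathcal{F}_{\mathbf{V}}\cap\mathcal{K}$, $A\leq_{\ast}^{\mathrm{ff}}B$ implies $A\preccurlyeq B$; and $(\mathcal{K},\preccurlyeq)$ has AP and JEP. Monster model, types, stability. $B\in\mathcal{K}$ is $(\kappa,\preccurlyeq)$-universal if every $C\in\mathcal{K}$ with $|C|\leq\kappa$ strongly embeds in $B$; it is $(\kappa,\preccurlyeq)$-homogeneous if every isomorphism between strong substructures $A_0,A_1\preccurlyeq B$ of size $<\kappa$ extends to an automorphism of $B$. Given AP and JEP, such models exist for all $\kappa\geq\mathrm{LS}(\mathcal{K},\preccurlyeq)$; the monster model $\mathfrak{M}$ is a $(\kappa,\preccurlyeq)$-homogeneous and $(\kappa,\preccurlyeq)$-universal model for some large enough $\kappa$. For $B\preccurlyeq\mathfrak{M}$ of size $<\kappa$, the Galois type $\mathrm{tp}(a/B)$ of $a\in\mathfrak{M}$ is the orbit of $a$ under the automorphisms of $\mathfrak{M}$ fixing $B$ pointwise, and $S(B)$ is the set of Galois types over $B$. $(\mathcal{K},\preccurlyeq)$ is $\lambda$-stable if $|S(B)|\leq\lambda$ for every $B\preccurlyeq\mathfrak{M}$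 with $|B|=\lambda$; it is superstable if it is $\lambda$-stable for all sufficiently large $\lambda$. Strong enough. The covering $(\mathcal{K},\preccurlyeq)$ of $(\mathcal{F}_{\mathbf{V}},\leq_{\ast}^{\mathrm{ff}})$ is strong enough if: (i) whenever $A,B,C\in\mathcal{F}^{\infty}_{\mathbf{V}}$ and $A\preccurlyeq B$, then $A\ast C\preccurlyeq B\ast C$; (ii) if $A$ and $B$ (with $b_0$) are as in $(\mathrm{RCP})$ and $B\preccurlyeq M\in\mathcal{K}$, then $\mathrm{dcl}^{\mathrm{qf}}_B(Ab_0)=\mathrm{dcl}^{\mathrm{qf}}_M(Ab_0)$; (iii) if $A$ and $B$ (with $b_0$) are as in $(\mathrm{RCP})$, with $B\preccurlyeq\mathfrak{M}$, and $f$ is an automorphism of the monster model $\mathfrak{M}$ fixing $A$ pointwise, then $\mathrm{dcl}^{\mathrm{qf}}_{\mathfrak{M}}(Ab_0)=\mathrm{dcl}^{\mathrm{qf}}_{\mathfrak{M}}(Af(b_0))$. *)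

theory Defs
  imports Main "HOL-Library.Countable_Set"
begin

unbundle cardinal_syntax

section \<open>The set-theoretic universe\<close>

text \<open>
  HOL has no proper classes.  The universe of sets is rendered by a type \<open>'u\<close> whose
  cardinality is a strongly inaccessible cardinal: subsets of \<open>'u\<close> of smaller cardinality play
  the role of sets, and a class of structures is an arbitrary set of structures whose
  carriers are small subsets of \<open>'u\<close>.  Cardinals are the small
  cardinal orders on subsets of \<open>'u\<close>.
\<close>

definition inaccessible :: "'u rel \<Rightarrow> bool" where
  "inaccessible \<kappa> \<longleftrightarrow> Card_order \<kappa> \<and> natLeq <o \<kappa> \<and> regularCard \<kappa> \<and>
     (\<forall>X :: 'u set. |X| <o \<kappa> \<longrightarrow> |Pow X| <o \<kappa>)"

definition small :: "'u set \<Rightarrow> bool" where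
  "small X \<longleftrightarrow> |X| <o |UNIV :: 'u set|"

definition cardinal :: "'u rel \<Rightarrow> bool" where
  "cardinal \<kappa> \<longleftrightarrow> Card_order \<kappa> \<and> \<kappa> <o |UNIV :: 'u set|"


section \<open>Structures\<close>

text \<open>
  A language is a set \<open>L\<close> of pairs (function symbol, arity).  The interpretation is
  \<open>undefined\<close> outside of its proper domain, so that equality of structures is HOL equality.
  The empty structure is admitted; it matters only as the free algebra of rank 0 in the
  absence of constants.
\<close>

record ('f, 'u) alg =
  carrier :: "'u set"
  interp :: "'f \<Rightarrow> 'u list \<Rightarrow> 'u"

definition is_structure :: "('f \<times> nat) set \<Rightarrow> ('f, 'u) alg \<Rightarrow> bool" where
  "is_structure L A \<longleftrightarrow> small (carrier A) \<and>
     (\<forall>f xs. if (f, length xs) \<in> L \<and> set xs \<subseteq> carrier A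
             then interp A f xs \<in> carrier A else interp A f xs = undefined)"

definition induced :: "('f \<times> nat) set \<Rightarrow> ('f, 'u) alg \<Rightarrow> 'u set \<Rightarrow> ('f, 'u) alg" where
  "induced L B X = \<lparr>carrier = X,
     interp = (\<lambda>f xs. if (f, length xs) \<in> L \<and> set xs \<subseteq> X then interp B f xs else undefined)\<rparr>"

definition substructure :: "('f \<times> nat) set \<Rightarrow> ('f, 'u) alg \<Rightarrow> ('f, 'u) alg \<Rightarrow> bool" where
  "substructure L A B \<longleftrightarrow> is_structure L A \<and> is_structure L B \<and>
     carrier A \<subseteq> carrier B \<and> A = induced L B (carrier A)"

inductive_set closure_in :: "('f \<times> nat) set \<Rightarrow> ('f, 'u) alg \<Rightarrow> 'u set \<Rightarrow> 'u set"
  for L :: "('f \<times> nat) set" and B :: "('f, 'u) alg" and X :: "'u set" where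
  base: "x \<in> X \<Longrightarrow> x \<in> closure_in L B X"
| step: "(f, length xs) \<in> L \<Longrightarrow> \<forall>x \<in> set xs. x \<in> closure_in L B X
           \<Longrightarrow> interp B f xs \<in> closure_in L B X"

definition generated :: "('f \<times> nat) set \<Rightarrow> ('f, 'u) alg \<Rightarrow> 'u set \<Rightarrow> ('f, 'u) alg" where
  "generated L B X = induced L B (closure_in L B X)"

definition hom :: "('f \<times> nat) set \<Rightarrow> ('f, 'u) alg \<Rightarrow> ('f, 'u) alg \<Rightarrow> ('u \<Rightarrow> 'u) \<Rightarrow> bool" where
  "hom L A B h \<longleftrightarrow> is_structure L A \<and> is_structure L B \<and> h ` carrier A \<subseteq> carrier B \<and>
     (\<forall>f xs. (f, length xs) \<in> L \<and> set xs \<subseteq> carrier A \<longrightarrow>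
        h (interp A f xs) = interp B f (map h xs))"

text \<open>The language has no relation symbols, so embeddings are the injective homomorphisms.\<close>

definition embedding :: "('f \<times> nat) set \<Rightarrow> ('f, 'u) alg \<Rightarrow> ('f, 'u) alg \<Rightarrow> ('u \<Rightarrow> 'u) \<Rightarrow> bool" where
  "embedding L A B h \<longleftrightarrow> hom L A B h \<and> inj_on h (carrier A)"

definition iso :: "('f \<times> nat) set \<Rightarrow> ('f, 'u) alg \<Rightarrow> ('f, 'u) alg \<Rightarrow> ('u \<Rightarrow> 'u) \<Rightarrow> bool" where
  "iso L A B h \<longleftrightarrow> hom L A B h \<and> bij_betw h (carrier A) (carrier B)"

abbreviation automorphism :: "('f \<times> nat) set \<Rightarrow> ('f, 'u) alg \<Rightarrow> ('u \<Rightarrow> 'u) \<Rightarrow> bool" where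
  "automorphism L M h \<equiv> iso L M M h"


section \<open>Terms, quantifier-free formulas and definable closure\<close>

datatype ('f, trm_vars: 'v) trm = Var 'v | App 'f "('f, 'v) trm list"

primrec wf_trm :: "('f \<times> nat) set \<Rightarrow> ('f, 'v) trm \<Rightarrow> bool" where
  "wf_trm L (Var x) \<longleftrightarrow> True"
| "wf_trm L (App f ts) \<longleftrightarrow> (f, length ts) \<in> L \<and> list_all (wf_trm L) ts"

primrec eval_trm :: "('f, 'u) alg \<Rightarrow> ('v \<Rightarrow> 'u) \<Rightarrow> ('f, 'v) trm \<Rightarrow> 'u" where
  "eval_trm A v (Var x) = v x"
| "eval_trm A v (App f ts) = interp A f (map (eval_trm A v) ts)"

datatype ('f, qf_vars: 'v) qf =
  Eq "('f, 'v) trm" "('f, 'v) trm"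
| Neg "('f, 'v) qf"
| Conj "('f, 'v) qf" "('f, 'v) qf"

primrec wf_qf :: "('f \<times> nat) set \<Rightarrow> ('f, 'v) qf \<Rightarrow> bool" where
  "wf_qf L (Eq s t) \<longleftrightarrow> wf_trm L s \<and> wf_trm L t"
| "wf_qf L (Neg \<phi>) \<longleftrightarrow> wf_qf L \<phi>"
| "wf_qf L (Conj \<phi> \<psi>) \<longleftrightarrow> wf_qf L \<phi> \<and> wf_qf L \<psi>"

primrec sat :: "('f, 'u) alg \<Rightarrow> ('v \<Rightarrow> 'u) \<Rightarrow> ('f, 'v) qf \<Rightarrow> bool" where
  "sat A v (Eq s t) \<longleftrightarrow> eval_trm A v s = eval_trm A v t"
| "sat A v (Neg \<phi>) \<longleftrightarrow> \<not> sat A v \<phi>"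
| "sat A v (Conj \<phi> \<psi>) \<longleftrightarrow> sat A v \<phi> \<and> sat A v \<psi>"

text \<open>
  Formulas in one free variable with parameters: the variable \<open>None\<close> is the one to be solved
  for, and \<open>Some c\<close> is the parameter \<open>c\<close>, standing for itself.
\<close>

definition dcl_qf :: "('f \<times> nat) set \<Rightarrow> ('f, 'u) alg \<Rightarrow> 'u set \<Rightarrow> 'u set" where
  "dcl_qf L B C = {b \<in> carrier B. \<exists>\<phi> :: ('f, 'u option) qf.
     wf_qf L \<phi> \<and> qf_vars \<phi> \<subseteq> insert None (Some ` C) \<and>
     {x \<in> carrier B. sat B (case_option x (\<lambda>c. c)) \<phi>} = {b}}"


section \<open>Varieties, free algebras and free products\<close>

definition satisfies_identity :: "('f, 'u) alg \<Rightarrow> ('f, nat) trm \<times> ('f, nat) trm \<Rightarrow> bool" where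
  "satisfies_identity A e \<longleftrightarrow>
     (\<forall>v. range v \<subseteq> carrier A \<longrightarrow> eval_trm A v (fst e) = eval_trm A v (snd e))"

definition variety :: "('f \<times> nat) set \<Rightarrow> ('f, 'u) alg set \<Rightarrow> bool" where
  "variety L V \<longleftrightarrow> (\<exists>E :: (('f, nat) trm \<times> ('f, nat) trm) set.
     (\<forall>e \<in> E. wf_trm L (fst e) \<and> wf_trm L (snd e)) \<and>
     V = {A. is_structure L A \<and> (\<forall>e \<in> E. satisfies_identity A e)})"

definition freely_generated ::
  "('f \<times> nat) set \<Rightarrow> ('f, 'u) alg set \<Rightarrow> ('f, 'u) alg \<Rightarrow> 'u set \<Rightarrow> bool" where
  "freely_generated L V F X \<longleftrightarrow> F \<in> V \<and> X \<subseteq> carrier F \<and> F = generated L F X \<and>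
     (\<forall>A \<in> V. \<forall>g. g ` X \<subseteq> carrier A \<longrightarrow> (\<exists>h. hom L F A h \<and> (\<forall>x \<in> X. h x = g x)))"

definition free_algs :: "('f \<times> nat) set \<Rightarrow> ('f, 'u) alg set \<Rightarrow> ('f, 'u) alg set" where
  "free_algs L V = {F. \<exists>X. freely_generated L V F X}"

definition free_algs_inf :: "('f \<times> nat) set \<Rightarrow> ('f, 'u) alg set \<Rightarrow> ('f, 'u) alg set" where
  "free_algs_inf L V = {F. \<exists>X. infinite X \<and> freely_generated L V F X}"

text \<open>
  \<open>free_product L V A C B\<close>: the algebra \<open>B\<close> is the internal free product of its
  subalgebras \<open>A\<close> and \<open>C\<close>, i.e. their coproduct in \<open>V\<close> via the inclusion maps.
\<close>

definition free_product ::
  "('f \<times> nat) set \<Rightarrow> ('f, 'u) alg set \<Rightarrow> ('f, 'u) alg \<Rightarrow> ('f, 'u) alg \<Rightarrow> ('f, 'u) alg \<Rightarrow> bool" where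
  "free_product L V A C B \<longleftrightarrow> A \<in> V \<and> C \<in> V \<and> B \<in> V \<and>
     substructure L A B \<and> substructure L C B \<and>
     (\<forall>D \<in> V. \<forall>f g. hom L A D f \<and> hom L C D g \<longrightarrow>
        (\<exists>h. hom L B D h \<and> (\<forall>x \<in> carrier A. h x = f x) \<and> (\<forall>x \<in> carrier C. h x = g x) \<and>
          (\<forall>h'. hom L B D h' \<and> (\<forall>x \<in> carrier A. h' x = f x) \<and> (\<forall>x \<in> carrier C. h' x = g x)
             \<longrightarrow> (\<forall>x \<in> carrier B. h' x = h x))))"

definition free_factor ::
  "('f \<times> nat) set \<Rightarrow> ('f, 'u) alg set \<Rightarrow> ('f, 'u) alg \<Rightarrow> ('f, 'u) alg \<Rightarrow> bool" where
  "free_factor L V A B \<longleftrightarrow> A \<in> free_algs L V \<and> B \<in> free_algs L V \<and>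
     (\<exists>C \<in> free_algs L V. free_product L V A C B)"


section \<open>The Reinforced Construction Principle\<close>

text \<open>
  The external free product of \<open>B\<close> and \<open>C\<close>, which is determined up to isomorphism, is rendered by ranging over all algebras \<open>D\<close> that are the internal
  free product of \<open>B\<close> and some \<open>C\<close>.
\<close>

definition RCP_witness ::
  "('f \<times> nat) set \<Rightarrow> ('f, 'u) alg set \<Rightarrow> ('f, 'u) alg \<Rightarrow> ('f, 'u) alg \<Rightarrow> 'u \<Rightarrow> bool" where
  "RCP_witness L V A B b0 \<longleftrightarrow>
     A \<in> free_algs_inf L V \<and> B \<in> free_algs_inf L V \<and>
     countable (carrier A) \<and> countable (carrier B) \<and> substructure L A B \<and>
     (\<exists>a :: nat \<Rightarrow> 'u. inj a \<and> freely_generated L V A (range a) \<and>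
        (\<forall>i. free_factor L V (generated L B (a ` {..i})) B)) \<and>
     (\<forall>C \<in> free_algs L V. \<forall>D. free_product L V B C D \<longrightarrow> \<not> free_factor L V A D) \<and>
     (\<exists>b :: nat \<Rightarrow> 'u. inj b \<and> freely_generated L V B (range b) \<and> b 0 = b0 \<and>
        dcl_qf L B (insert b0 (carrier A)) = carrier B)"

definition RCP :: "('f \<times> nat) set \<Rightarrow> ('f, 'u) alg set \<Rightarrow> bool" where
  "RCP L V \<longleftrightarrow> (\<exists>A B b0. RCP_witness L V A B b0)"


section \<open>Abstract elementary classes\<close>

type_synonym ('f, 'u) strong_rel = "('f, 'u) alg \<Rightarrow> ('f, 'u) alg \<Rightarrow> bool"

definition is_union ::
  "('f \<times> nat) set \<Rightarrow> ('f, 'u) alg set \<Rightarrow> ('f, 'u) alg \<Rightarrow> bool" where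
  "is_union L \<A> U \<longleftrightarrow> carrier U = (\<Union>A \<in> \<A>. carrier A) \<and> (\<forall>A \<in> \<A>. substructure L A U)"

text \<open>
  The nonzero ordinal \<open>\<delta>\<close> indexing a chain is a nonempty small well-order \<open>r\<close> on a subset of \<open>'u\<close>.
\<close>

definition limit_point :: "'u rel \<Rightarrow> 'u \<Rightarrow> bool" where
  "limit_point r i \<longleftrightarrow> i \<in> Field r \<and> underS r i \<noteq> {} \<and>
     (\<forall>j \<in> underS r i. \<exists>k \<in> underS r i. j \<in> underS r k)"

definition continuous_chain ::
  "('f \<times> nat) set \<Rightarrow> ('f, 'u) alg set \<Rightarrow> ('f, 'u) strong_rel \<Rightarrow> 'u rel \<Rightarrow> ('u \<Rightarrow> ('f, 'u) alg) \<Rightarrow> bool"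
where
  "continuous_chain L K le r M \<longleftrightarrow>
     Well_order r \<and> Field r \<noteq> {} \<and> small (Field r) \<and>
     (\<forall>i \<in> Field r. M i \<in> K) \<and>
     (\<forall>i j. (i, j) \<in> r \<longrightarrow> le (M i) (M j)) \<and>
     (\<forall>i. limit_point r i \<longrightarrow> is_union L (M ` underS r i) (M i))"

definition LS_bound ::
  "('f \<times> nat) set \<Rightarrow> ('f, 'u) alg set \<Rightarrow> ('f, 'u) strong_rel \<Rightarrow> 'u rel \<Rightarrow> bool" where
  "LS_bound L K le \<mu> \<longleftrightarrow> cardinal \<mu> \<and> |L| +c natLeq \<le>o \<mu> \<and>
     (\<forall>A \<in> K. \<forall>X \<subseteq> carrier A. \<exists>C \<in> K. X \<subseteq> carrier C \<and> le C A \<and> |carrier C| \<le>o |X| +c \<mu>)"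

definition AEC :: "('f \<times> nat) set \<Rightarrow> ('f, 'u) alg set \<Rightarrow> ('f, 'u) strong_rel \<Rightarrow> bool" where
  "AEC L K le \<longleftrightarrow>
     (\<forall>A \<in> K. is_structure L A) \<and>
     (\<forall>A B. le A B \<longrightarrow> A \<in> K \<and> B \<in> K) \<and>
     \<comment> \<open>closure under isomorphism\<close>
     (\<forall>A \<in> K. \<forall>B h. iso L A B h \<longrightarrow> B \<in> K) \<and>
     (\<forall>A B A' B' h. le A B \<and> iso L B B' h \<and> iso L A A' h \<longrightarrow> le A' B') \<and>
     \<comment> \<open>a partial order refining the substructure relation\<close>
     (\<forall>A B. le A B \<longrightarrow> substructure L A B) \<and>
     (\<forall>A \<in> K. le A A) \<and>
     (\<forall>A B C. le A B \<and> le B C \<longrightarrow> le A C) \<and>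
     (\<forall>A B. le A B \<and> le B A \<longrightarrow> A = B) \<and>
     \<comment> \<open>chains\<close>
     (\<forall>r M U. continuous_chain L K le r M \<and> is_union L (M ` Field r) U \<longrightarrow>
        U \<in> K \<and> (\<forall>j \<in> Field r. le (M j) U) \<and>
        (\<forall>B \<in> K. (\<forall>i \<in> Field r. le (M i) B) \<longrightarrow> le U B)) \<and>
     \<comment> \<open>coherence\<close>
     (\<forall>A B C. A \<in> K \<and> B \<in> K \<and> C \<in> K \<and> le A C \<and> le B C \<and> substructure L A B \<longrightarrow> le A B) \<and>
     \<comment> \<open>Loewenheim-Skolem\<close>
     (\<exists>\<mu>. LS_bound L K le \<mu>)"

definition strong_embedding ::
  "('f \<times> nat) set \<Rightarrow> ('f, 'u) strong_rel \<Rightarrow> ('f, 'u) alg \<Rightarrow> ('f, 'u) alg \<Rightarrow> ('u \<Rightarrow> 'u) \<Rightarrow> bool" where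
  "strong_embedding L le A B h \<longleftrightarrow> embedding L A B h \<and> le (induced L B (h ` carrier A)) B"

definition AP :: "('f \<times> nat) set \<Rightarrow> ('f, 'u) alg set \<Rightarrow> ('f, 'u) strong_rel \<Rightarrow> bool" where
  "AP L K le \<longleftrightarrow> (\<forall>A \<in> K. \<forall>B \<in> K. \<forall>C \<in> K. \<forall>f g.
     strong_embedding L le A B f \<and> strong_embedding L le A C g \<longrightarrow>
     (\<exists>D \<in> K. \<exists>f' g'. strong_embedding L le B D f' \<and> strong_embedding L le C D g' \<and>
        (\<forall>x \<in> carrier A. f' (f x) = g' (g x))))"

definition JEP :: "('f \<times> nat) set \<Rightarrow> ('f, 'u) alg set \<Rightarrow> ('f, 'u) strong_rel \<Rightarrow> bool" where
  "JEP L K le \<longleftrightarrow> (\<forall>A \<in> K. \<forall>B \<in> K. \<exists>D \<in> K. \<exists>f g.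
     strong_embedding L le A D f \<and> strong_embedding L le B D g)"

definition AEC_covering ::
  "('f \<times> nat) set \<Rightarrow> ('f, 'u) alg set \<Rightarrow> ('f, 'u) alg set \<Rightarrow> ('f, 'u) strong_rel \<Rightarrow> bool" where
  "AEC_covering L V K le \<longleftrightarrow>
     free_algs_inf L V \<subseteq> K \<and> AEC L K le \<and>
     (\<forall>A B. A \<in> free_algs L V \<inter> K \<and> B \<in> free_algs L V \<inter> K \<and> free_factor L V A B \<longrightarrow> le A B) \<and>
     AP L K le \<and> JEP L K le"


section \<open>Monster models, Galois types and stability\<close>

definition universal_model ::
  "('f \<times> nat) set \<Rightarrow> ('f, 'u) alg set \<Rightarrow> ('f, 'u) strong_rel \<Rightarrow> 'u rel \<Rightarrow> ('f, 'u) alg \<Rightarrow> bool" where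
  "universal_model L K le \<kappa> M \<longleftrightarrow>
     (\<forall>C \<in> K. |carrier C| \<le>o \<kappa> \<longrightarrow> (\<exists>h. strong_embedding L le C M h))"

definition homogeneous_model ::
  "('f \<times> nat) set \<Rightarrow> ('f, 'u) strong_rel \<Rightarrow> 'u rel \<Rightarrow> ('f, 'u) alg \<Rightarrow> bool" where
  "homogeneous_model L le \<kappa> M \<longleftrightarrow>
     (\<forall>A0 A1 h. le A0 M \<and> le A1 M \<and> |carrier A0| <o \<kappa> \<and> |carrier A1| <o \<kappa> \<and> iso L A0 A1 h \<longrightarrow>
        (\<exists>g. automorphism L M g \<and> (\<forall>x \<in> carrier A0. g x = h x)))"

text \<open>Here \<open>\<kappa>\<close> exceeds the Loewenheim-Skolem number.\<close>

definition monster ::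
  "('f \<times> nat) set \<Rightarrow> ('f, 'u) alg set \<Rightarrow> ('f, 'u) strong_rel \<Rightarrow> 'u rel \<Rightarrow> ('f, 'u) alg \<Rightarrow> bool" where
  "monster L K le \<kappa> M \<longleftrightarrow> cardinal \<kappa> \<and> (\<exists>\<mu>. LS_bound L K le \<mu> \<and> \<mu> <o \<kappa>) \<and> M \<in> K \<and>
     universal_model L K le \<kappa> M \<and> homogeneous_model L le \<kappa> M"

definition galois_type ::
  "('f \<times> nat) set \<Rightarrow> ('f, 'u) alg \<Rightarrow> 'u set \<Rightarrow> 'u \<Rightarrow> 'u set" where
  "galois_type L M X a = {h a | h. automorphism L M h \<and> (\<forall>x \<in> X. h x = x)}"

definition galois_types :: "('f \<times> nat) set \<Rightarrow> ('f, 'u) alg \<Rightarrow> 'u set \<Rightarrow> 'u set set" where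
  "galois_types L M X = galois_type L M X ` carrier M"

text \<open>
  Stability in \<open>lam\<close> is computed in a monster model for some \<open>\<kappa> > lam\<close>.  By homogeneity and
  universality the outcome does not depend on the choice of \<open>\<kappa>\<close> and of the monster model (for
  \<open>lam\<close> at least the Loewenheim-Skolem number), and under AP and JEP monster models exist.
\<close>

definition stable_in ::
  "('f \<times> nat) set \<Rightarrow> ('f, 'u) alg set \<Rightarrow> ('f, 'u) strong_rel \<Rightarrow> 'u rel \<Rightarrow> bool" where
  "stable_in L K le lam \<longleftrightarrow> (\<exists>\<kappa> M. lam <o \<kappa> \<and> monster L K le \<kappa> M \<and>
     (\<forall>B. le B M \<and> |carrier B| =o lam \<longrightarrow> |galois_types L M (carrier B)| \<le>o lam))"

definition superstable ::
  "('f \<times> nat) set \<Rightarrow> ('f, 'u) alg set \<Rightarrow> ('f, 'u) strong_rel \<Rightarrow> bool" where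
  "superstable L K le \<longleftrightarrow>
     (\<exists>\<mu> :: 'u rel. cardinal \<mu> \<and> (\<forall>lam. cardinal lam \<and> \<mu> \<le>o lam \<longrightarrow> stable_in L K le lam))"


section \<open>Strong enough coverings\<close>

text \<open>
  In the first clause the free products \<open>E\<close> of \<open>A\<close> and \<open>C\<close>, and \<open>D\<close> of \<open>B\<close> and \<open>C\<close>, are taken
  with the same \<open>C\<close> and such that the canonical map from \<open>E\<close> to \<open>D\<close> is the inclusion.
\<close>

definition strong_enough ::
  "('f \<times> nat) set \<Rightarrow> ('f, 'u) alg set \<Rightarrow> ('f, 'u) alg set \<Rightarrow> ('f, 'u) strong_rel \<Rightarrow> bool" where
  "strong_enough L V K le \<longleftrightarrow>
     (\<forall>A \<in> free_algs_inf L V. \<forall>B \<in> free_algs_inf L V. \<forall>C \<in> free_algs_inf L V. \<forall>E D.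
        le A B \<and> free_product L V A C E \<and> free_product L V B C D \<and> substructure L E D \<longrightarrow> le E D) \<and>
     (\<forall>A B b0. RCP_witness L V A B b0 \<longrightarrow> (\<forall>M \<in> K. le B M \<longrightarrow>
        dcl_qf L B (insert b0 (carrier A)) = dcl_qf L M (insert b0 (carrier A)))) \<and>
     (\<forall>A B b0. RCP_witness L V A B b0 \<longrightarrow> (\<forall>\<kappa> M f.
        monster L K le \<kappa> M \<and> le B M \<and> automorphism L M f \<and> (\<forall>x \<in> carrier A. f x = x) \<longrightarrow>
        dcl_qf L M (insert b0 (carrier A)) = dcl_qf L M (insert (f b0) (carrier A))))"

end

theory Submission
  imports Defs
begin

text \<open>
  Let \<open>S\<close> be a large set that is a countable union of sets of smaller cardinality, so that there are
  more than \<open>|S|\<close> sequences in \<open>S\<close> by Koenig's argument.  Let \<open>B\<close>, with \<open>A\<close> freely generated by the \<open>a i\<close>, witness RCP, and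
  embed the free product \<open>N\<close> of \<open>B\<close> and the free algebra on a set \<open>Z\<close> of size \<open>|S|\<close> strongly into
  the monster model \<open>M\<close>.  Since each \<open>a 0, ..., a n\<close> extends to a basis of \<open>B\<close>, the algebra \<open>N0\<close>
  generated by \<open>A\<close> and \<open>Z\<close> is free on the \<open>a i\<close> and \<open>Z\<close>, and it is the union of an \<open>\<omega>\<close>-chain of
  free factors of \<open>N\<close>, hence strong in \<open>M\<close>.  Indexing \<open>Z\<close> by the tree of finite sequences in
  \<open>S\<close>, every branch gives an automorphism of \<open>N0\<close> that moves the \<open>a i\<close> to the nodes of the branch; it
  extends to \<open>M\<close> and moves \<open>b0\<close> to a realisation of some type over \<open>N0\<close>.

  Suppose two branches that share finitely many nodes gave the same type.  Then some automorphism
  of \<open>M\<close> fixes \<open>b0\<close> and moves every \<open>a i\<close> into \<open>{a 0, ..., a m}\<close> or a countable subset \<open>C\<close> of \<open>Z\<close>.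
  As the orbit of \<open>b0\<close> over \<open>A\<close> lies in its definable closure, which is the countable algebra
  \<open>B\<close>, the orbit of \<open>b0\<close> over \<open>a 0, ..., a m\<close> and \<open>C\<close> is countable too.  Exchanging basis
  elements with fresh elements of \<open>Z\<close> shows that \<open>b0\<close> is then generated by \<open>a 0, ..., a m\<close>.
  Hence \<open>B\<close> is the definable closure of \<open>A\<close>, which by the same exchange equals \<open>A\<close>, and \<open>A\<close> is a
  free factor of \<open>N\<close>, contradicting RCP.
\<close>

section \<open>Structures and homomorphisms\<close>

lemma carrier_induced [simp]: "carrier (induced L B X) = X"
  by (simp add: induced_def)

lemma carrier_generated [simp]: "carrier (generated L B X) = closure_in L B X"
  by (simp add: generated_def)

lemma alg_eqI: "carrier A = carrier B \<Longrightarrow> interp A = interp B \<Longrightarrow> A = (B :: ('f, 'u) alg)"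
  by (cases A, cases B) auto

lemma small_subset: "small Y \<Longrightarrow> X \<subseteq> Y \<Longrightarrow> small X"
  unfolding small_def using card_of_mono1 ordLeq_ordLess_trans by blast

lemma structure_small: "is_structure L A \<Longrightarrow> small (carrier A)"
  by (simp add: is_structure_def)

lemma structure_closed:
  "is_structure L A \<Longrightarrow> (f, length xs) \<in> L \<Longrightarrow> set xs \<subseteq> carrier A \<Longrightarrow> interp A f xs \<in> carrier A"
  unfolding is_structure_def by metis

lemma structure_undefined:
  "is_structure L A \<Longrightarrow> \<not> ((f, length xs) \<in> L \<and> set xs \<subseteq> carrier A) \<Longrightarrow> interp A f xs = undefined"
  unfolding is_structure_def by metis

section \<open>Generated subsets and their finitary character\<close>

lemma closure_in_minimal:
  assumes "X \<subseteq> Y" "\<And>f xs. (f, length xs) \<in> L \<Longrightarrow> set xs \<subseteq> Y \<Longrightarrow> interp B f xs \<in> Y"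
  shows "closure_in L B X \<subseteq> Y"
proof
  fix x assume "x \<in> closure_in L B X"
  then show "x \<in> Y"
    by induction (use assms in \<open>auto simp: subset_iff\<close>)
qed

lemma closure_in_closed:
  "(f, length xs) \<in> L \<Longrightarrow> set xs \<subseteq> closure_in L B X \<Longrightarrow> interp B f xs \<in> closure_in L B X"
  by (rule closure_in.step) auto

lemma closure_in_base: "X \<subseteq> closure_in L B X"
  by (auto intro: closure_in.base)

lemma closure_in_subset_iff: "closure_in L B X \<subseteq> closure_in L B Y \<longleftrightarrow> X \<subseteq> closure_in L B Y"
  by (meson closure_in_base closure_in_closed closure_in_minimal subset_trans)

lemma closure_in_mono: "X \<subseteq> Y \<Longrightarrow> closure_in L B X \<subseteq> closure_in L B Y"
  by (meson closure_in_base closure_in_subset_iff subset_trans)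

lemma closure_in_subset_carrier:
  "is_structure L B \<Longrightarrow> X \<subseteq> carrier B \<Longrightarrow> closure_in L B X \<subseteq> carrier B"
  by (rule closure_in_minimal) (auto intro: structure_closed)

lemma finite_chain_bound:
  assumes "finite F" "F \<subseteq> (\<Union>n. C n)" "\<And>m n. m \<le> n \<Longrightarrow> C m \<subseteq> C (n :: nat)"
  shows "\<exists>n. F \<subseteq> C n"
  using assms(1,2)
proof (induction F)
  case (insert x F)
  then obtain n m where nm: "F \<subseteq> C n" "x \<in> C m"
    by auto
  with assms(3)[of n "max n m"] assms(3)[of m "max n m"] have "insert x F \<subseteq> C (max n m)"
    by auto
  then show ?case ..
qed simp

text \<open>A derivation of an element applies finitely many operations of finite arity, so the
  finitely many generators at its leaves suffice.\<close>

lemma closure_in_finitary: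
  assumes "x \<in> closure_in L B X"
  shows "\<exists>W. finite W \<and> W \<subseteq> X \<and> x \<in> closure_in L B W"
  using assms
proof induction
  case (base x)
  then show ?case
    by (intro exI[of _ "{x}"]) (auto intro: closure_in.base)
next
  case (step f xs)
  then obtain W where W: "\<And>x. x \<in> set xs \<Longrightarrow> finite (W x) \<and> W x \<subseteq> X \<and> x \<in> closure_in L B (W x)"
    by metis
  have "interp B f xs \<in> closure_in L B (\<Union>x\<in>set xs. W x)"
  proof (rule closure_in_closed[OF step(1)], rule subsetI)
    fix x assume "x \<in> set xs"
    then show "x \<in> closure_in L B (\<Union>x\<in>set xs. W x)"
      using W[of x] closure_in_mono[of "W x" "\<Union>x\<in>set xs. W x" L B] by blast
  qed
  then show ?case
    using W by (intro exI[of _ "\<Union>x\<in>set xs. W x"]) auto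
qed

text \<open>Finitary character puts each element of the left side into the closure of finitely many
  generators, and these already lie in one stage.\<close>

lemma closure_in_chain:
  assumes "\<And>m n. m \<le> n \<Longrightarrow> C m \<subseteq> C (n :: nat)"
  shows "closure_in L B (\<Union>n. C n) = (\<Union>n. closure_in L B (C n))"
proof
  show "closure_in L B (\<Union>n. C n) \<subseteq> (\<Union>n. closure_in L B (C n))"
  proof
    fix x assume "x \<in> closure_in L B (\<Union>n. C n)"
    from closure_in_finitary[OF this] obtain W
      where W: "finite W" "W \<subseteq> (\<Union>n. C n)" "x \<in> closure_in L B W"
      by auto
    then obtain n where "W \<subseteq> C n"
      using finite_chain_bound[of W C] assms by metis
    then show "x \<in> (\<Union>n. closure_in L B (C n))"
      using W(3) closure_in_mono[of W "C n" L B] by blast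
  qed
  show "(\<Union>n. closure_in L B (C n)) \<subseteq> closure_in L B (\<Union>n. C n)"
    by (intro UN_least closure_in_mono) auto
qed

section \<open>Substructures\<close>

lemma substructure_induced:
  assumes "is_structure L B" "X \<subseteq> carrier B"
    and "\<And>f xs. (f, length xs) \<in> L \<Longrightarrow> set xs \<subseteq> X \<Longrightarrow> interp B f xs \<in> X"
  shows "substructure L (induced L B X) B"
proof -
  have "small X"
    using small_subset[OF structure_small[OF assms(1)] assms(2)] .
  then show ?thesis
    using assms by (simp add: substructure_def is_structure_def induced_def)
qed

lemma substructure_generated:
  "is_structure L B \<Longrightarrow> X \<subseteq> carrier B \<Longrightarrow> substructure L (generated L B X) B"
  unfolding generated_def
  by (intro substructure_induced closure_in_subset_carrier closure_in_closed)

lemma substructureD: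
  assumes "substructure L A B"
  shows "is_structure L A" "is_structure L B" "carrier A \<subseteq> carrier B"
  using assms by (auto simp: substructure_def)

lemma substructure_interp:
  assumes "substructure L A B" "(f, length xs) \<in> L" "set xs \<subseteq> carrier A"
  shows "interp A f xs = interp B f xs"
proof -
  have "A = induced L B (carrier A)"
    using assms(1) by (simp add: substructure_def)
  then have "interp A f xs = interp (induced L B (carrier A)) f xs"
    by simp
  then show ?thesis
    using assms by (simp add: induced_def)
qed

lemma substructureI:
  assumes "is_structure L A" "is_structure L B" "carrier A \<subseteq> carrier B"
    and "\<And>f xs. (f, length xs) \<in> L \<Longrightarrow> set xs \<subseteq> carrier A \<Longrightarrow> interp A f xs = interp B f xs"
  shows "substructure L A B"
  unfolding substructure_def using assms
  by (auto intro!: alg_eqI ext simp: induced_def structure_undefined)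

lemma substructure_trans:
  assumes "substructure L A B" "substructure L B C"
  shows "substructure L A C"
proof (rule substructureI)
  fix f xs assume "(f, length xs) \<in> L" "set xs \<subseteq> carrier A"
  then show "interp A f xs = interp C f xs"
    using substructure_interp[OF assms(1), of f xs] substructure_interp[OF assms(2), of f xs]
      substructureD[OF assms(1)] by auto
qed (use assms[THEN substructureD(1)] assms[THEN substructureD(2)] assms[THEN substructureD(3)] in auto)

lemma substructure_subset:
  assumes "substructure L A C" "substructure L B C" "carrier A \<subseteq> carrier B"
  shows "substructure L A B"
proof (rule substructureI)
  fix f xs assume "(f, length xs) \<in> L" "set xs \<subseteq> carrier A"
  then show "interp A f xs = interp B f xs"
    using substructure_interp[OF assms(1), of f xs] substructure_interp[OF assms(2), of f xs]
      assms(3) by auto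
qed (use assms(3) assms(1,2)[THEN substructureD(1)] in auto)

lemma substructure_eqI:
  assumes "substructure L A C" "substructure L B C" "carrier A = carrier B"
  shows "A = B"
  using assms by (metis substructure_def)

lemma closure_in_substructure:
  assumes "substructure L A B" "X \<subseteq> carrier A"
  shows "closure_in L A X = closure_in L B X"
proof
  have A: "closure_in L A X \<subseteq> carrier A"
    using assms closure_in_subset_carrier substructureD(1) by blast
  show "closure_in L A X \<subseteq> closure_in L B X"
  proof
    fix x assume "x \<in> closure_in L A X"
    then show "x \<in> closure_in L B X"
    proof induction
      case (step f xs)
      then have "interp A f xs = interp B f xs"
        using A by (intro substructure_interp[OF assms(1)]) auto
      then show ?case
        using step by (auto intro: closure_in.step)
    qed (rule closure_in.base)
  qed
  show "closure_in L B X \<subseteq> closure_in L A X"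
  proof (rule closure_in_minimal[OF closure_in_base])
    fix f xs assume *: "(f, length xs) \<in> L" "set xs \<subseteq> closure_in L A X"
    then have "interp A f xs = interp B f xs"
      using A by (intro substructure_interp[OF assms(1)]) auto
    then show "interp B f xs \<in> closure_in L A X"
      using closure_in_closed[OF *] by simp
  qed
qed

lemma generated_substructure:
  assumes "substructure L A B" "X \<subseteq> carrier A"
  shows "generated L A X = generated L B X"
proof (rule substructure_eqI)
  show "substructure L (generated L A X) B"
    using substructure_trans[OF substructure_generated[OF substructureD(1)[OF assms(1)] assms(2)] assms(1)] .
  show "substructure L (generated L B X) B"
    using substructureD(3)[OF assms(1)] assms(2)
    by (intro substructure_generated[OF substructureD(2)[OF assms(1)]]) auto
  show "carrier (generated L A X) = carrier (generated L B X)"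
    by (simp add: closure_in_substructure[OF assms])
qed

section \<open>Homomorphisms\<close>

lemma homD:
  assumes "hom L A B h"
  shows "is_structure L A" "is_structure L B" "h ` carrier A \<subseteq> carrier B"
    "\<And>x. x \<in> carrier A \<Longrightarrow> h x \<in> carrier B"
    "\<And>f xs. (f, length xs) \<in> L \<Longrightarrow> set xs \<subseteq> carrier A \<Longrightarrow> h (interp A f xs) = interp B f (map h xs)"
  using assms by (auto simp: hom_def)

lemma hom_comp:
  assumes "hom L A B h" "hom L B C k"
  shows "hom L A C (k \<circ> h)"
  unfolding hom_def
proof (intro conjI allI impI)
  fix f xs assume *: "(f, length xs) \<in> L \<and> set xs \<subseteq> carrier A"
  then have "set (map h xs) \<subseteq> carrier B"
    using homD(4)[OF assms(1)] by auto
  with * show "(k \<circ> h) (interp A f xs) = interp C f (map (k \<circ> h) xs)"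
    using homD(5)[OF assms(1), of f xs] homD(5)[OF assms(2), of f "map h xs"] by simp
qed (use homD[OF assms(1)] homD[OF assms(2)] in auto)

lemma hom_inclusion: "substructure L A B \<Longrightarrow> hom L A B id"
  unfolding hom_def using substructureD[of L A B] substructure_interp[of L A B]
  by (simp add: list.map_id0)

lemma hom_restrict: "hom L B C h \<Longrightarrow> substructure L A B \<Longrightarrow> hom L A C h"
  using hom_comp[OF hom_inclusion, of L A B C h] by simp

lemma hom_extend: "hom L A B h \<Longrightarrow> substructure L B C \<Longrightarrow> hom L A C h"
  using hom_comp[OF _ hom_inclusion, of L A B h C] by simp

lemma hom_into:
  assumes "hom L A C h" "substructure L B C" "h ` carrier A \<subseteq> carrier B"
  shows "hom L A B h"
  unfolding hom_def
proof (intro conjI allI impI)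
  fix f xs assume *: "(f, length xs) \<in> L \<and> set xs \<subseteq> carrier A"
  then have "set (map h xs) \<subseteq> carrier B"
    using assms(3) by auto
  with * show "h (interp A f xs) = interp B f (map h xs)"
    using homD(5)[OF assms(1), of f xs] substructure_interp[OF assms(2), of f "map h xs"] by simp
qed (use assms(3) homD[OF assms(1)] substructureD[OF assms(2)] in auto)

lemma hom_cong: "hom L A B h \<Longrightarrow> (\<And>x. x \<in> carrier A \<Longrightarrow> h x = k x) \<Longrightarrow> hom L A B k"
  unfolding hom_def
proof (intro conjI allI impI; (elim conjE)?)
  fix f xs
  assume h: "\<And>x. x \<in> carrier A \<Longrightarrow> h x = k x" and A: "is_structure L A"
    and eq: "\<forall>f xs. (f, length xs) \<in> L \<and> set xs \<subseteq> carrier A \<longrightarrow> h (interp A f xs) = interp B f (map h xs)"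
    and *: "(f, length xs) \<in> L" "set xs \<subseteq> carrier A"
  have "map h xs = map k xs"
    using * h by auto
  then show "k (interp A f xs) = interp B f (map k xs)"
    using eq * h[OF structure_closed[OF A *]] by metis
qed auto

lemma hom_image_closure_in:
  assumes "hom L A B h" "X \<subseteq> carrier A"
  shows "h ` closure_in L A X = closure_in L B (h ` X)"
proof
  note A = closure_in_subset_carrier[OF homD(1)[OF assms(1)] assms(2)]
  show "h ` closure_in L A X \<subseteq> closure_in L B (h ` X)"
  proof safe
    fix x assume "x \<in> closure_in L A X"
    then show "h x \<in> closure_in L B (h ` X)"
    proof induction
      case (step f xs)
      then have "h (interp A f xs) = interp B f (map h xs)"
        using A by (intro homD(5)[OF assms(1)]) auto
      moreover have "interp B f (map h xs) \<in> closure_in L B (h ` X)"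
        using step by (intro closure_in_closed) auto
      ultimately show ?case
        by simp
    qed (auto intro: closure_in.base)
  qed
  show "closure_in L B (h ` X) \<subseteq> h ` closure_in L A X"
  proof (rule closure_in_minimal)
    show "h ` X \<subseteq> h ` closure_in L A X"
      by (auto intro: closure_in.base)
    fix f ys assume *: "(f, length ys) \<in> L" "set ys \<subseteq> h ` closure_in L A X"
    then have "ys \<in> map h ` lists (closure_in L A X)"
      by (auto simp flip: lists_image)
    then obtain xs where xs: "ys = map h xs" "set xs \<subseteq> closure_in L A X"
      by auto
    then have "interp B f ys = h (interp A f xs)"
      using homD(5)[OF assms(1), of f xs] * A by auto
    moreover have "interp A f xs \<in> closure_in L A X"
      using xs * by (intro closure_in_closed) auto
    ultimately show "interp B f ys \<in> h ` closure_in L A X"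
      by simp
  qed
qed

lemma hom_eq_on_closure_in:
  assumes "hom L A B h" "hom L A B k" "X \<subseteq> carrier A" "\<And>x. x \<in> X \<Longrightarrow> h x = k x"
    and "x \<in> closure_in L A X"
  shows "h x = k x"
  using assms(5)
proof induction
  case (step f xs)
  then have "set xs \<subseteq> carrier A"
    using closure_in_subset_carrier[OF homD(1)[OF assms(1)] assms(3)] by auto
  moreover have "map h xs = map k xs"
    using step by auto
  ultimately show ?case
    using homD(5)[OF assms(1) step(1)] homD(5)[OF assms(2) step(1)] by metis
qed (use assms(4) in auto)

section \<open>Isomorphisms and transport of structure\<close>

lemma isoD:
  assumes "iso L A B h"
  shows "hom L A B h" "bij_betw h (carrier A) (carrier B)" "inj_on h (carrier A)"
    "h ` carrier A = carrier B"
  using assms by (auto simp: iso_def bij_betw_def)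

lemma iso_inv_into:
  assumes "iso L A B h"
  shows "iso L B A (inv_into (carrier A) h)"
  unfolding iso_def hom_def
proof (intro conjI allI impI)
  let ?k = "inv_into (carrier A) h"
  show bij: "bij_betw ?k (carrier B) (carrier A)"
    using isoD(2)[OF assms] by (rule bij_betw_inv_into)
  then show img: "?k ` carrier B \<subseteq> carrier A"
    by (simp add: bij_betw_def)
  fix f xs assume *: "(f, length xs) \<in> L \<and> set xs \<subseteq> carrier B"
  then have sub: "set (map ?k xs) \<subseteq> carrier A"
    using img by auto
  have "map h (map ?k xs) = xs"
    using * isoD(4)[OF assms] by (auto intro!: map_idI simp: f_inv_into_f subset_iff)
  then have "h (interp A f (map ?k xs)) = interp B f xs"
    using homD(5)[OF isoD(1)[OF assms], of f "map ?k xs"] sub * by simp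
  moreover have "interp A f (map ?k xs) \<in> carrier A"
    using structure_closed[OF homD(1)[OF isoD(1)[OF assms]]] sub * by auto
  ultimately show "?k (interp B f xs) = interp A f (map ?k xs)"
    using inv_into_f_f[OF isoD(3)[OF assms]] by metis
qed (use homD(1,2)[OF isoD(1)[OF assms]] in auto)

lemma iso_comp: "iso L A B h \<Longrightarrow> iso L B C k \<Longrightarrow> iso L A C (k \<circ> h)"
  unfolding iso_def using hom_comp bij_betw_trans by metis

lemma iso_cong: "iso L A B h \<Longrightarrow> (\<And>x. x \<in> carrier A \<Longrightarrow> h x = k x) \<Longrightarrow> iso L A B k"
  unfolding iso_def using hom_cong bij_betw_cong by metis

lemma iso_if_mutually_inverse:
  assumes "hom L A B h" "hom L B A k"
    and "\<And>x. x \<in> carrier A \<Longrightarrow> k (h x) = x" "\<And>y. y \<in> carrier B \<Longrightarrow> h (k y) = y"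
  shows "iso L A B h"
  unfolding iso_def using assms homD(3)[OF assms(1)] homD(3)[OF assms(2)]
  by (auto intro: bij_betw_byWitness[where f' = k])

text \<open>Homomorphisms commute with generation, so the image of the whole carrier is closed under
  the operations of \<open>B\<close>.\<close>

lemma embedding_iso_image:
  assumes "embedding L A B h"
  shows "substructure L (induced L B (h ` carrier A)) B"
    and "iso L A (induced L B (h ` carrier A)) h"
proof -
  have h: "hom L A B h" "inj_on h (carrier A)"
    using assms by (auto simp: embedding_def)
  have "closure_in L A (carrier A) = carrier A"
    using closure_in_subset_carrier[OF homD(1)[OF h(1)] order_refl] closure_in_base
    by (rule subset_antisym)
  then have "closure_in L B (h ` carrier A) = h ` carrier A"
    using hom_image_closure_in[OF h(1) order_refl] by simp
  then show sub: "substructure L (induced L B (h ` carrier A)) B"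
    using substructure_generated[OF homD(2,3)[OF h(1)]] by (simp add: generated_def)
  then show "iso L A (induced L B (h ` carrier A)) h"
    using hom_into[OF h(1) sub] h(2) by (simp add: iso_def bij_betw_def)
qed

text \<open>The operations are carried over through the inverse of \<open>j\<close>. Injectivity on
  the carrier makes this well defined, and smallness passes to the image.\<close>

lemma iso_copy_exists:
  fixes A :: "('f, 'u) alg" and j :: "'u \<Rightarrow> 'u"
  assumes "is_structure L A" "inj_on j (carrier A)"
  shows "\<exists>B. carrier B = j ` carrier A \<and> iso L A B j"
proof -
  let ?k = "inv_into (carrier A) j"
  define B :: "('f, 'u) alg" where "B = \<lparr>carrier = j ` carrier A, interp = (\<lambda>f ys.
    if (f, length ys) \<in> L \<and> set ys \<subseteq> j ` carrier A then j (interp A f (map ?k ys)) else undefined)\<rparr>"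
  have "small (j ` carrier A)"
    using structure_small[OF assms(1)] card_of_image ordLeq_ordLess_trans unfolding small_def by blast
  moreover have "interp A f (map ?k ys) \<in> carrier A"
    if "(f, length ys) \<in> L" "set ys \<subseteq> j ` carrier A" for f ys
    using that by (intro structure_closed[OF assms(1)]) (auto simp: inv_into_into subset_iff)
  ultimately have B: "is_structure L B"
    by (auto simp: is_structure_def B_def)
  have "j (interp A f xs) = interp B f (map j xs)" if "(f, length xs) \<in> L" "set xs \<subseteq> carrier A" for f xs
  proof -
    have "map ?k (map j xs) = xs"
      using that assms(2) by (auto intro!: map_idI simp: subset_iff)
    then show ?thesis
      using that by (auto simp: B_def simp del: map_map)
  qed
  then have "iso L A B j"
    using B assms by (simp add: iso_def hom_def B_def bij_betw_def)
  then show ?thesis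
    by (intro exI[of _ B]) (simp add: B_def)
qed

section \<open>Terms and quantifier-free formulas under homomorphisms\<close>

lemma eval_trm_in_closure_in:
  "wf_trm L t \<Longrightarrow> v ` trm_vars t \<subseteq> X \<Longrightarrow> eval_trm A v t \<in> closure_in L A X"
proof (induction t)
  case (App f ts)
  then have "eval_trm A v t \<in> closure_in L A X" if "t \<in> set ts" for t
    using that by (intro App.IH) (auto simp: list_all_iff)
  then show ?case
    using App by (auto intro!: closure_in_closed)
qed (auto intro: closure_in.base)

lemma eval_trm_in_carrier:
  "is_structure L A \<Longrightarrow> wf_trm L t \<Longrightarrow> v ` trm_vars t \<subseteq> carrier A \<Longrightarrow> eval_trm A v t \<in> carrier A"
  using closure_in_subset_carrier[of L A "carrier A"] eval_trm_in_closure_in[of L t v "carrier A" A] by auto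

lemma eval_trm_hom:
  assumes "hom L A B h"
  shows "wf_trm L t \<Longrightarrow> v ` trm_vars t \<subseteq> carrier A \<Longrightarrow> eval_trm B (\<lambda>x. h (v x)) t = h (eval_trm A v t)"
proof (induction t)
  case (App f ts)
  have IH: "eval_trm B (\<lambda>x. h (v x)) t = h (eval_trm A v t)" "eval_trm A v t \<in> carrier A" if "t \<in> set ts" for t
    using that App.prems eval_trm_in_carrier[OF homD(1)[OF assms], of t v]
    by (auto intro!: App.IH simp: list_all_iff SUP_le_iff image_UN)
  have "h (interp A f (map (eval_trm A v) ts)) = interp B f (map h (map (eval_trm A v) ts))"
    using App.prems IH by (intro homD(5)[OF assms]) auto
  moreover have "map h (map (eval_trm A v) ts) = map (eval_trm B (\<lambda>x. h (v x))) ts"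
    using IH by auto
  ultimately show ?case
    by (simp only: eval_trm.simps)
qed simp

lemma eval_trm_cong: "(\<And>x. x \<in> trm_vars t \<Longrightarrow> v x = w x) \<Longrightarrow> eval_trm A v t = eval_trm A w t"
proof (induction t)
  case (App f ts)
  then have "map (eval_trm A v) ts = map (eval_trm A w) ts"
    by auto
  then show ?case
    by (simp del: map_eq_conv)
qed simp

text \<open>Injectivity is what makes equations reflected as well as preserved, so that negation
  causes no trouble.\<close>

lemma sat_iso:
  assumes "iso L A B h"
  shows "wf_qf L \<phi> \<Longrightarrow> v ` qf_vars \<phi> \<subseteq> carrier A \<Longrightarrow> sat B (\<lambda>x. h (v x)) \<phi> \<longleftrightarrow> sat A v \<phi>"
proof (induction \<phi>)
  case (Eq s t)
  then show ?case
    using eval_trm_hom[OF isoD(1)[OF assms], of s v] eval_trm_hom[OF isoD(1)[OF assms], of t v]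
      eval_trm_in_carrier[OF homD(1)[OF isoD(1)[OF assms]], of s v]
      eval_trm_in_carrier[OF homD(1)[OF isoD(1)[OF assms]], of t v] isoD(3)[OF assms]
    by (auto simp: image_Un inj_on_eq_iff)
qed (auto simp: image_Un)

lemma sat_cong: "(\<And>x. x \<in> qf_vars \<phi> \<Longrightarrow> v x = w x) \<Longrightarrow> sat A v \<phi> \<longleftrightarrow> sat A w \<phi>"
proof (induction \<phi>)
  case (Eq s t)
  then show ?case
    using eval_trm_cong[of s v w A] eval_trm_cong[of t v w A] by simp
qed auto

section \<open>Free algebras\<close>

lemma variety_structure: "variety L V \<Longrightarrow> A \<in> V \<Longrightarrow> is_structure L A"
  by (auto simp: variety_def)

text \<open>If an identity of the variety failed in \<open>F\<close>, a homomorphism into a member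
  of \<open>V\<close> separating the two values would make it fail there too. This gives membership
  in \<open>V\<close> for subalgebras and, later, for the algebra of term functions, without forming
  products.\<close>

lemma variety_separated:
  assumes V: "variety L V" and F: "is_structure L F"
    and sep: "\<And>x y. x \<in> carrier F \<Longrightarrow> y \<in> carrier F \<Longrightarrow> x \<noteq> y \<Longrightarrow> \<exists>D\<in>V. \<exists>h. hom L F D h \<and> h x \<noteq> h y"
  shows "F \<in> V"
proof -
  obtain E where wf: "\<And>e. e \<in> E \<Longrightarrow> wf_trm L (fst e) \<and> wf_trm L (snd e)"
    and VE: "V = {A. is_structure L A \<and> (\<forall>e \<in> E. satisfies_identity A e)}"
    using V unfolding variety_def by blast
  have "satisfies_identity F e" if e: "e \<in> E" for e
    unfolding satisfies_identity_def
  proof (intro allI impI)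
    fix v :: "nat \<Rightarrow> _" assume v: "range v \<subseteq> carrier F"
    show "eval_trm F v (fst e) = eval_trm F v (snd e)" (is "?l = ?r")
    proof (rule ccontr)
      assume "?l \<noteq> ?r"
      moreover have "?l \<in> carrier F" "?r \<in> carrier F"
        using v wf[OF e] by (auto intro!: eval_trm_in_carrier[OF F])
      ultimately obtain D h where D: "D \<in> V" "hom L F D h" "h ?l \<noteq> h ?r"
        using sep by blast
      have "range (\<lambda>x. h (v x)) \<subseteq> carrier D"
        using v homD(4)[OF D(2)] by auto
      then have "eval_trm D (\<lambda>x. h (v x)) (fst e) = eval_trm D (\<lambda>x. h (v x)) (snd e)"
        using D(1) e by (simp add: VE satisfies_identity_def)
      moreover have "v ` trm_vars (fst e) \<subseteq> carrier F" "v ` trm_vars (snd e) \<subseteq> carrier F"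
        using v by auto
      ultimately show False
        using eval_trm_hom[OF D(2), of "fst e" v] eval_trm_hom[OF D(2), of "snd e" v] wf[OF e] D(3)
        by simp
    qed
  qed
  then show ?thesis
    using F by (simp add: VE)
qed

lemma variety_embedding:
  assumes "variety L V" "embedding L A B h" "B \<in> V"
  shows "A \<in> V"
proof (rule variety_separated[OF assms(1)])
  show "is_structure L A"
    using assms(2) homD(1) by (auto simp: embedding_def)
qed (use assms in \<open>auto simp: embedding_def inj_on_def\<close>)

lemma variety_substructure: "variety L V \<Longrightarrow> substructure L A B \<Longrightarrow> B \<in> V \<Longrightarrow> A \<in> V"
  by (rule variety_embedding[where h = id]) (auto simp: embedding_def hom_inclusion)

lemma variety_iso:
  assumes "variety L V" "iso L A B h" "A \<in> V"
  shows "B \<in> V"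
  using variety_embedding[OF assms(1) _ assms(3)] iso_inv_into[OF assms(2)]
  by (meson embedding_def isoD(1) isoD(3))

lemma freely_generatedD:
  assumes "freely_generated L V F X"
  shows "F \<in> V" "X \<subseteq> carrier F" "F = generated L F X" "carrier F = closure_in L F X"
  using assms carrier_generated[of L F X] by (auto simp: freely_generated_def)

lemma freely_generated_structure: "variety L V \<Longrightarrow> freely_generated L V F X \<Longrightarrow> is_structure L F"
  using variety_structure freely_generatedD(1) by blast

lemma freely_generated_extend:
  assumes "freely_generated L V F X" "A \<in> V" "g ` X \<subseteq> carrier A"
  obtains h where "hom L F A h" "\<And>x. x \<in> X \<Longrightarrow> h x = g x"
  using assms unfolding freely_generated_def by blast

lemma freely_generatedI:
  assumes V: "variety L V" and F: "F \<in> V" and X: "X \<subseteq> carrier F" and gen: "carrier F \<subseteq> closure_in L F X"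
    and ext: "\<And>A g. A \<in> V \<Longrightarrow> g ` X \<subseteq> carrier A \<Longrightarrow> \<exists>h. hom L F A h \<and> (\<forall>x \<in> X. h x = g x)"
  shows "freely_generated L V F X"
  unfolding freely_generated_def
proof (intro conjI ballI allI impI)
  have sF: "is_structure L F"
    using V F by (rule variety_structure)
  show "F = generated L F X"
  proof (rule substructure_eqI)
    show "substructure L F F"
      by (rule substructureI) (auto simp: sF)
    show "substructure L (generated L F X) F"
      using sF X by (rule substructure_generated)
    show "carrier F = carrier (generated L F X)"
      using closure_in_subset_carrier[OF sF X] gen by simp
  qed
qed (use F X ext in auto)

lemma substructure_refl: "is_structure L A \<Longrightarrow> substructure L A A"
  by (rule substructureI) auto

lemma freely_generated_subset:
  assumes V: "variety L V" and F: "freely_generated L V F X" and Y: "Y \<subseteq> X" "Y \<noteq> {}"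
  shows "freely_generated L V (generated L F Y) Y"
proof (rule freely_generatedI[OF V])
  have YF: "Y \<subseteq> carrier F"
    using Y freely_generatedD(2)[OF F] by auto
  have sub: "substructure L (generated L F Y) F"
    using freely_generated_structure[OF V F] YF by (rule substructure_generated)
  show "generated L F Y \<in> V"
    using V sub freely_generatedD(1)[OF F] by (rule variety_substructure)
  show Yg: "Y \<subseteq> carrier (generated L F Y)"
    by (simp add: closure_in_base)
  show "carrier (generated L F Y) \<subseteq> closure_in L (generated L F Y) Y"
    using closure_in_substructure[OF sub Yg] by simp
  fix A g assume A: "A \<in> V" "g ` Y \<subseteq> carrier A"
  \<comment> \<open>The value \<open>g y\<close> serves as the default for the basis elements
    outside \<open>Y\<close>; it exists because \<open>Y\<close> is nonempty.\<close>
  obtain y where "y \<in> Y"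
    using Y by auto
  then have "(\<lambda>x. if x \<in> Y then g x else g y) ` X \<subseteq> carrier A"
    using A by auto
  from freely_generated_extend[OF F A(1) this] obtain h
    where "hom L F A h" "\<And>x. x \<in> X \<Longrightarrow> h x = (if x \<in> Y then g x else g y)"
    by blast
  then show "\<exists>h. hom L (generated L F Y) A h \<and> (\<forall>x \<in> Y. h x = g x)"
    using hom_restrict[OF _ sub] Y by (intro exI[of _ h]) auto
qed

text \<open>The homomorphisms that extend \<open>g\<close> on the stages agree where they overlap,
  since they agree on generators, and therefore glue. An operation has finitely many arguments, so
  compatibility can be checked inside one stage.\<close>

lemma freely_generated_chain:
  assumes V: "variety L V" and F: "F \<in> V"
    and mono: "\<And>m n. m \<le> n \<Longrightarrow> X m \<subseteq> X (n :: nat)" and sub: "\<And>n. X n \<subseteq> carrier F"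
    and free: "\<And>n. freely_generated L V (generated L F (X n)) (X n)"
  shows "freely_generated L V (generated L F (\<Union>n. X n)) (\<Union>n. X n)"
proof (rule freely_generatedI[OF V])
  let ?X = "\<Union>n. X n" let ?F = "generated L F ?X"
  have sF: "is_structure L F"
    using V F by (rule variety_structure)
  have XF: "?X \<subseteq> carrier F"
    using sub by auto
  have subF: "substructure L ?F F"
    using sF XF by (rule substructure_generated)
  show "?F \<in> V"
    using V subF F by (rule variety_substructure)
  show Xg: "?X \<subseteq> carrier ?F"
    by (simp add: closure_in_base)
  show "carrier ?F \<subseteq> closure_in L ?F ?X"
    using closure_in_substructure[OF subF Xg] by simp
  fix A g assume A: "A \<in> V" "g ` ?X \<subseteq> carrier A"
  have "\<exists>h. hom L (generated L F (X n)) A h \<and> (\<forall>x\<in>X n. h x = g x)" for n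
  proof -
    have "g ` X n \<subseteq> carrier A"
      using A(2) by auto
    then show ?thesis
      using free A(1) unfolding freely_generated_def by blast
  qed
  then obtain H where H: "\<And>n. hom L (generated L F (X n)) A (H n)" "\<And>n x. x \<in> X n \<Longrightarrow> H n x = g x"
    by metis
  have subs: "substructure L (generated L F (X n)) F" for n
    using sF sub by (rule substructure_generated)
  have agree: "H m x = H n x" if "m \<le> n" "x \<in> closure_in L F (X m)" for m n x
  proof (rule hom_eq_on_closure_in[OF H(1)[of m], where X = "X m"])
    have "substructure L (generated L F (X m)) (generated L F (X n))"
      using that closure_in_mono[OF mono[OF that(1)]] by (intro substructure_subset[OF subs subs]) auto
    then show "hom L (generated L F (X m)) A (H n)"
      by (rule hom_restrict[OF H(1)])
    show "X m \<subseteq> carrier (generated L F (X m))"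
      by (simp add: closure_in_base)
    then show "x \<in> closure_in L (generated L F (X m)) (X m)"
      using closure_in_substructure[OF subs] that by simp
  qed (use H(2) mono[OF that(1)] in auto)
  \<comment> \<open>The least stage is an arbitrary choice; by \<open>agree\<close> any stage
    containing \<open>x\<close> gives the same value.\<close>
  define h where "h x = H (LEAST n. x \<in> closure_in L F (X n)) x" for x
  have h: "h x = H n x" if "x \<in> closure_in L F (X n)" for n x
  proof -
    let ?P = "\<lambda>n. x \<in> closure_in L F (X n)"
    have "(LEAST n. ?P n) \<le> n" "?P (LEAST n. ?P n)"
      using that by (auto intro: Least_le LeastI)
    then show ?thesis
      unfolding h_def by (rule agree)
  qed
  have cF: "carrier ?F = (\<Union>n. closure_in L F (X n))"
    using closure_in_chain[of X L F] mono by simp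
  have "hom L ?F A h"
    unfolding hom_def
  proof (intro conjI allI impI)
    show "h ` carrier ?F \<subseteq> carrier A"
      unfolding cF using homD(4)[OF H(1)] h by auto
    fix f xs assume *: "(f, length xs) \<in> L \<and> set xs \<subseteq> carrier ?F"
    then obtain n where n: "set xs \<subseteq> closure_in L F (X n)"
      using finite_chain_bound[of "set xs" "\<lambda>n. closure_in L F (X n)", OF _ _ closure_in_mono[OF mono]]
      unfolding cF by auto
    have "interp ?F f xs = interp F f xs" "interp (generated L F (X n)) f xs = interp F f xs"
      using * n by (auto intro!: substructure_interp[OF subF] substructure_interp[OF subs])
    moreover have "interp F f xs \<in> closure_in L F (X n)"
      using * n by (auto intro: closure_in_closed)
    moreover have "map h xs = map (H n) xs"
      using n h by auto
    ultimately show "h (interp ?F f xs) = interp A f (map h xs)"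
      using homD(5)[OF H(1)[of n], of f xs] * n h by (metis carrier_generated)
  qed (use substructureD[OF subF] variety_structure[OF V A(1)] in auto)
  moreover have "h x = g x" if "x \<in> ?X" for x
    using that h H(2) closure_in.base[of x] by fastforce
  ultimately show "\<exists>h. hom L ?F A h \<and> (\<forall>x \<in> ?X. h x = g x)"
    by blast
qed

text \<open>The extensions of \<open>p\<close> and of its inverse compose to homomorphisms that fix
  the bases, hence to identities. With \<open>F = G\<close> this turns permutations of a basis into
  automorphisms.\<close>

lemma freely_generated_bij:
  assumes V: "variety L V" and F: "freely_generated L V F X" and G: "freely_generated L V G Y"
    and p: "bij_betw p X Y"
  obtains h where "iso L F G h" "\<And>x. x \<in> X \<Longrightarrow> h x = p x"
proof -
  have "p ` X \<subseteq> carrier G"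
    using p freely_generatedD(2)[OF G] by (auto simp: bij_betw_def)
  from freely_generated_extend[OF F freely_generatedD(1)[OF G] this]
  obtain h where h: "hom L F G h" "\<And>x. x \<in> X \<Longrightarrow> h x = p x"
    by blast
  have "inv_into X p ` Y \<subseteq> carrier F"
    using bij_betw_inv_into[OF p] freely_generatedD(2)[OF F] by (auto simp: bij_betw_def)
  from freely_generated_extend[OF G freely_generatedD(1)[OF F] this]
  obtain k where k: "hom L G F k" "\<And>y. y \<in> Y \<Longrightarrow> k y = inv_into X p y"
    by blast
  have "iso L F G h"
  proof (rule iso_if_mutually_inverse[OF h(1) k(1)])
    fix x assume "x \<in> carrier F"
    then have x: "x \<in> closure_in L F X"
      using freely_generatedD(4)[OF F] by simp
    have "(k \<circ> h) x = id x"
    proof (rule hom_eq_on_closure_in[OF hom_comp[OF h(1) k(1)] hom_inclusion freely_generatedD(2)[OF F] _ x])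
      show "substructure L F F"
        using freely_generated_structure[OF V F] by (rule substructure_refl)
      fix z assume "z \<in> X"
      then show "(k \<circ> h) z = id z"
        using h k p by (auto simp: bij_betw_def)
    qed
    then show "k (h x) = x"
      by simp
  next
    fix y assume "y \<in> carrier G"
    then have y: "y \<in> closure_in L G Y"
      using freely_generatedD(4)[OF G] by simp
    have "(h \<circ> k) y = id y"
    proof (rule hom_eq_on_closure_in[OF hom_comp[OF k(1) h(1)] hom_inclusion freely_generatedD(2)[OF G] _ y])
      show "substructure L G G"
        using freely_generated_structure[OF V G] by (rule substructure_refl)
      fix z assume "z \<in> Y"
      then show "(h \<circ> k) z = id z"
        using h k p by (auto simp: bij_betw_def f_inv_into_f inv_into_into)
    qed
    then show "h (k y) = y"
      by simp
  qed
  with h(2) that show thesis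
    by blast
qed

lemma freely_generated_iso:
  assumes V: "variety L V" and F: "freely_generated L V F X" and h: "iso L F G h"
  shows "freely_generated L V G (h ` X)"
proof (rule freely_generatedI[OF V])
  show "G \<in> V"
    using V h freely_generatedD(1)[OF F] by (rule variety_iso)
  show "h ` X \<subseteq> carrier G"
    using homD(3)[OF isoD(1)[OF h]] freely_generatedD(2)[OF F] by auto
  show "carrier G \<subseteq> closure_in L G (h ` X)"
    using hom_image_closure_in[OF isoD(1)[OF h] freely_generatedD(2)[OF F]] freely_generatedD(4)[OF F]
      isoD(4)[OF h] by simp
  fix A g assume A: "A \<in> V" "g ` h ` X \<subseteq> carrier A"
  then have "(g \<circ> h) ` X \<subseteq> carrier A"
    by auto
  from freely_generated_extend[OF F A(1) this]
  obtain k where k: "hom L F A k" "\<And>x. x \<in> X \<Longrightarrow> k x = (g \<circ> h) x"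
    by blast
  let ?i = "inv_into (carrier F) h"
  have "(k \<circ> ?i) (h x) = g (h x)" if "x \<in> X" for x
    using that k(2) isoD(3)[OF h] freely_generatedD(2)[OF F] by (simp add: subset_iff)
  then show "\<exists>h'. hom L G A h' \<and> (\<forall>x \<in> h ` X. h' x = g x)"
    using hom_comp[OF isoD(1)[OF iso_inv_into[OF h]] k(1)] by blast
qed

section \<open>Free products and free factors in terms of bases\<close>

lemma free_product_of_basis_split:
  assumes V: "variety L V" and F: "freely_generated L V F (X \<union> Y)"
    and XY: "X \<inter> Y = {}" "X \<noteq> {}" "Y \<noteq> {}"
  shows "free_product L V (generated L F X) (generated L F Y) F"
  unfolding free_product_def
proof (intro conjI ballI allI impI; (elim conjE)?)
  have sF: "is_structure L F" and XF: "X \<subseteq> carrier F" and YF: "Y \<subseteq> carrier F"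
    using freely_generated_structure[OF V F] freely_generatedD(2)[OF F] by auto
  show subX: "substructure L (generated L F X) F"
    using sF XF by (rule substructure_generated)
  show subY: "substructure L (generated L F Y) F"
    using sF YF by (rule substructure_generated)
  show "F \<in> V"
    by (rule freely_generatedD(1)[OF F])
  then show "generated L F X \<in> V" "generated L F Y \<in> V"
    using variety_substructure[OF V subX] variety_substructure[OF V subY] by auto
  fix D f g assume D: "D \<in> V" and f: "hom L (generated L F X) D f" and g: "hom L (generated L F Y) D g"
  have "f ` X \<subseteq> carrier D" "g ` Y \<subseteq> carrier D"
    using homD(4)[OF f] homD(4)[OF g] closure_in_base[of X L F] closure_in_base[of Y L F]
    by (auto simp: subset_iff)
  then have "(\<lambda>x. if x \<in> X then f x else g x) ` (X \<union> Y) \<subseteq> carrier D"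
    by auto
  from freely_generated_extend[OF F D this]
  obtain h where h: "hom L F D h" "\<And>x. x \<in> X \<union> Y \<Longrightarrow> h x = (if x \<in> X then f x else g x)"
    by blast
  have "h x = f x" if "x \<in> carrier (generated L F X)" for x
    by (rule hom_eq_on_closure_in[OF hom_restrict[OF h(1) subX] f, where X = X])
      (use that h(2) closure_in_base[of X L F] closure_in_substructure[OF subX, of X] in auto)
  moreover have "h x = g x" if "x \<in> carrier (generated L F Y)" for x
    by (rule hom_eq_on_closure_in[OF hom_restrict[OF h(1) subY] g, where X = Y])
      (use that h(2) XY closure_in_base[of Y L F] closure_in_substructure[OF subY, of Y] in auto)
  moreover have "h' x = h x" if h': "hom L F D h'" "\<forall>x\<in>carrier (generated L F X). h' x = f x"
      "\<forall>x\<in>carrier (generated L F Y). h' x = g x" and x: "x \<in> carrier F" for h' x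
  proof (rule hom_eq_on_closure_in[OF h'(1) h(1) freely_generatedD(2)[OF F]])
    fix y assume "y \<in> X \<union> Y"
    then show "h' y = h y"
      using h' h(2) closure_in.base[of y X L F] closure_in.base[of y Y L F] by auto
  qed (use x freely_generatedD(4)[OF F] in simp)
  ultimately show "\<exists>h. hom L F D h \<and> (\<forall>x\<in>carrier (generated L F X). h x = f x) \<and>
      (\<forall>x\<in>carrier (generated L F Y). h x = g x) \<and>
      (\<forall>h'. hom L F D h' \<and> (\<forall>x\<in>carrier (generated L F X). h' x = f x) \<and>
         (\<forall>x\<in>carrier (generated L F Y). h' x = g x) \<longrightarrow> (\<forall>x\<in>carrier F. h' x = h x))"
    using h(1) by blast
qed

text \<open>Extending maps is immediate from the two universal properties. That \<open>X\<close> and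
  \<open>Y\<close> together generate \<open>B\<close> comes from the uniqueness part of the free
  product.\<close>

lemma free_product_basis:
  assumes V: "variety L V" and prod: "free_product L V A C B"
    and A: "freely_generated L V A X" and C: "freely_generated L V C Y"
  shows "freely_generated L V B (X \<union> Y)"
proof -
  have B: "B \<in> V" and subA: "substructure L A B" and subC: "substructure L C B"
    and univ: "\<And>D f g. D \<in> V \<Longrightarrow> hom L A D f \<Longrightarrow> hom L C D g \<Longrightarrow>
      \<exists>h. hom L B D h \<and> (\<forall>x \<in> carrier A. h x = f x) \<and> (\<forall>x \<in> carrier C. h x = g x) \<and>
          (\<forall>h'. hom L B D h' \<and> (\<forall>x \<in> carrier A. h' x = f x) \<and> (\<forall>x \<in> carrier C. h' x = g x)
             \<longrightarrow> (\<forall>x \<in> carrier B. h' x = h x))"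
    using prod unfolding free_product_def by blast+
  have sB: "is_structure L B"
    using V B by (rule variety_structure)
  have XY: "X \<subseteq> carrier A" "Y \<subseteq> carrier C"
    using freely_generatedD(2)[OF A] freely_generatedD(2)[OF C] .
  have XYB: "X \<union> Y \<subseteq> carrier B"
    using XY substructureD(3)[OF subA] substructureD(3)[OF subC] by auto
  let ?G = "generated L B (X \<union> Y)"
  have subG: "substructure L ?G B"
    using sB XYB by (rule substructure_generated)
  have "carrier A \<subseteq> carrier ?G" "carrier C \<subseteq> carrier ?G"
    using freely_generatedD(4)[OF A] freely_generatedD(4)[OF C] closure_in_substructure[OF subA XY(1)]
      closure_in_substructure[OF subC XY(2)] closure_in_mono[of X "X \<union> Y" L B]
      closure_in_mono[of Y "X \<union> Y" L B] by auto
  then have "hom L A ?G id" "hom L C ?G id"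
    using substructure_subset[OF subA subG] substructure_subset[OF subC subG] hom_inclusion by auto
  \<comment> \<open>The map \<open>r\<close> sends \<open>B\<close> into the subalgebra generated by
    both bases and fixes \<open>A\<close> and \<open>C\<close>. Regarded as an endomorphism of
    \<open>B\<close> it must be the identity, so that subalgebra is all of \<open>B\<close>.\<close>
  with univ[OF variety_substructure[OF V subG B]]
  obtain r where r: "hom L B ?G r" "\<forall>x \<in> carrier A. r x = id x" "\<forall>x \<in> carrier C. r x = id x"
    by blast
  obtain u where u: "\<forall>h'. hom L B B h' \<and> (\<forall>x \<in> carrier A. h' x = id x) \<and> (\<forall>x \<in> carrier C. h' x = id x)
             \<longrightarrow> (\<forall>x \<in> carrier B. h' x = u x)"
    using univ[OF B hom_inclusion[OF subA] hom_inclusion[OF subC]] by blast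
  have "hom L B B r"
    using hom_extend[OF r(1) subG] .
  moreover have "hom L B B id"
    using hom_inclusion[OF substructure_refl[OF sB]] .
  ultimately have "r x = x" if "x \<in> carrier B" for x
    using u r(2,3) that by (metis id_apply)
  then have gen: "carrier B \<subseteq> closure_in L B (X \<union> Y)"
    using homD(4)[OF r(1)] by fastforce
  show ?thesis
  proof (rule freely_generatedI[OF V B XYB gen])
    fix D g assume D: "D \<in> V" "g ` (X \<union> Y) \<subseteq> carrier D"
    then have "g ` X \<subseteq> carrier D" "g ` Y \<subseteq> carrier D"
      by auto
    then obtain f f' where f: "hom L A D f" "\<And>x. x \<in> X \<Longrightarrow> f x = g x"
      and f': "hom L C D f'" "\<And>x. x \<in> Y \<Longrightarrow> f' x = g x"
      using freely_generated_extend[OF A D(1)] freely_generated_extend[OF C D(1)] by metis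
    obtain h where "hom L B D h" "\<forall>x \<in> carrier A. h x = f x" "\<forall>x \<in> carrier C. h x = f' x"
      using univ[OF D(1) f(1) f'(1)] by blast
    then show "\<exists>h. hom L B D h \<and> (\<forall>x \<in> X \<union> Y. h x = g x)"
      using f(2) f'(2) XY by (intro exI[of _ h]) auto
  qed
qed

text \<open>In this form the clause of RCP on the initial segments of \<open>a\<close> is used: such
  a segment extends to a basis of \<open>B\<close>.\<close>

lemma free_factor_basis:
  assumes V: "variety L V" and "free_factor L V A B" and "freely_generated L V A X"
  obtains Y where "X \<subseteq> Y" "freely_generated L V B Y"
proof -
  obtain C Z where "free_product L V A C B" "freely_generated L V C Z"
    using assms(2) unfolding free_factor_def free_algs_def by blast
  then have "freely_generated L V B (X \<union> Z)"
    using free_product_basis[OF V _ assms(3)] by blast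
  then show thesis
    using that[of "X \<union> Z"] by blast
qed

text \<open>The complementary factor is generated by the rest of the basis; properness of the
  inclusion keeps that rest nonempty.\<close>

lemma free_factor_of_subbasis:
  assumes V: "variety L V" and F: "freely_generated L V F X" and Y: "Y \<subset> X" "Y \<noteq> {}"
  shows "free_factor L V (generated L F Y) F"
  unfolding free_factor_def free_algs_def
proof (intro conjI bexI CollectI exI)
  show "freely_generated L V (generated L F Y) Y" "freely_generated L V F X"
    "freely_generated L V (generated L F (X - Y)) (X - Y)"
    using freely_generated_subset[OF V F] F Y by auto
  have "Y \<union> (X - Y) = X"
    using Y by auto
  then show "free_product L V (generated L F Y) (generated L F (X - Y)) F"
    using free_product_of_basis_split[OF V, of F Y "X - Y"] F Y by auto
qed

text \<open>A map on \<open>Y\<close> and \<open>Z\<close> is extended first to the subalgebra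
  generated by \<open>Y1\<close>, for which \<open>Y\<close> is a basis, and then from its values on
  \<open>Y1\<close> and the given values on \<open>Z\<close> to \<open>N\<close>. Disjointness keeps
  the two prescriptions apart.\<close>

lemma freely_generated_exchange:
  assumes V: "variety L V" and N: "freely_generated L V N (Y1 \<union> Z)" and disj: "Y1 \<inter> Z = {}"
    and Y1: "freely_generated L V (generated L N Y1) Y"
  shows "freely_generated L V N (Y \<union> Z)"
proof -
  have sN: "is_structure L N" and Y1N: "Y1 \<subseteq> carrier N" and ZN: "Z \<subseteq> carrier N"
    using freely_generated_structure[OF V N] freely_generatedD(2)[OF N] by auto
  have sub: "substructure L (generated L N Y1) N"
    using sN Y1N by (rule substructure_generated)
  have Yg: "Y \<subseteq> closure_in L N Y1"
    using freely_generatedD(2)[OF Y1] by simp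
  then have YN: "Y \<subseteq> carrier N"
    using closure_in_subset_carrier[OF sN Y1N] by auto
  have clY: "closure_in L N Y = closure_in L N Y1"
    using freely_generatedD(4)[OF Y1] closure_in_substructure[OF sub] Yg by simp
  show ?thesis
  proof (rule freely_generatedI[OF V freely_generatedD(1)[OF N]])
    show "Y \<union> Z \<subseteq> carrier N"
      using YN ZN by auto
    have "Y1 \<union> Z \<subseteq> closure_in L N (Y \<union> Z)"
      using closure_in_base[of Y1 L N] clY closure_in_mono[of Y "Y \<union> Z" L N] closure_in_base[of "Y \<union> Z" L N]
      by auto
    then show "carrier N \<subseteq> closure_in L N (Y \<union> Z)"
      using freely_generatedD(4)[OF N] closure_in_subset_iff by metis
    fix A g assume A: "A \<in> V" "g ` (Y \<union> Z) \<subseteq> carrier A"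
    then have "g ` Y \<subseteq> carrier A"
      by auto
    from freely_generated_extend[OF Y1 A(1) this] obtain k
      where k: "hom L (generated L N Y1) A k" "\<And>x. x \<in> Y \<Longrightarrow> k x = g x"
      by blast
    have "k ` Y1 \<subseteq> carrier A"
      using homD(4)[OF k(1)] closure_in.base[of _ Y1 L N] by auto
    then have "(\<lambda>x. if x \<in> Y1 then k x else g x) ` (Y1 \<union> Z) \<subseteq> carrier A"
      using A by auto
    from freely_generated_extend[OF N A(1) this] obtain h
      where h: "hom L N A h" "\<And>x. x \<in> Y1 \<union> Z \<Longrightarrow> h x = (if x \<in> Y1 then k x else g x)"
      by blast
    have "h x = k x" if "x \<in> closure_in L N Y1" for x
      by (rule hom_eq_on_closure_in[OF hom_restrict[OF h(1) sub] k(1), where X = Y1])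
        (use that h(2) closure_in_base[of Y1 L N] closure_in_substructure[OF sub, of Y1] in auto)
    then have "h x = g x" if "x \<in> Y \<union> Z" for x
      using that h(2) k(2) Yg disj by auto
    then show "\<exists>h. hom L N A h \<and> (\<forall>x\<in>Y \<union> Z. h x = g x)"
      using h(1) by blast
  qed
qed

section \<open>Cardinality and existence of free algebras\<close>

text \<open>The lists of a fixed length are bounded by induction, since finite powers of an infinite
  set do not grow; there are countably many lengths.\<close>

lemma card_of_lists_ordLeq:
  assumes S: "infinite S" and A: "|A| \<le>o |S|"
  shows "|lists A| \<le>o |S|"
proof -
  have "|{xs \<in> lists A. length xs = n}| \<le>o |S|" for n
  proof (induction n)
    case 0
    have "{xs \<in> lists A. length xs = 0} = {[]}"
      by auto
    moreover have "|{[]}| \<le>o |S|"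
      using S by (intro card_of_singl_ordLeq) auto
    ultimately show ?case
      by simp
  next
    case (Suc n)
    have "{xs \<in> lists A. length xs = Suc n} \<subseteq> (\<lambda>(x, xs). x # xs) ` (A \<times> {xs \<in> lists A. length xs = n})"
      by (auto simp: length_Suc_conv image_iff)
    then have "|{xs \<in> lists A. length xs = Suc n}| \<le>o |A \<times> {xs \<in> lists A. length xs = n}|"
      using ordLeq_transitive[OF card_of_mono1 card_of_image] by simp
    also have "|A \<times> {xs \<in> lists A. length xs = n}| \<le>o |S|"
      using Suc A S by (intro card_of_Times_ordLeq_infinite_Field[where r = "|S|"]) (auto simp: card_of_card_order_on Field_card_of)
    finally show ?case .
  qed
  moreover have "lists A = (\<Union>n. {xs \<in> lists A. length xs = n})"
    by auto
  moreover have "|UNIV :: nat set| \<le>o |S|"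
    using S infinite_iff_card_of_nat by blast
  ultimately show ?thesis
    using card_of_UNION_ordLeq_infinite[OF S, of "UNIV :: nat set" "\<lambda>n. {xs \<in> lists A. length xs = n}"] by simp
qed

lemma countable_ordLeq:
  assumes "countable A" "infinite B"
  shows "|A| \<le>o |B|"
proof -
  obtain f :: "_ \<Rightarrow> nat" where "inj_on f A"
    using assms(1) by (rule countableE)
  then have "|A| \<le>o |UNIV :: nat set|"
    using card_of_ordLeq by blast
  then show ?thesis
    using assms(2) infinite_iff_card_of_nat ordLeq_transitive by blast
qed

lemma finite_trm_vars: "finite (trm_vars t)"
  by (induction t) auto

lemma card_of_trms_ordLeq:
  assumes S: "infinite S" and I: "|I| \<le>o |S|" and L: "countable L"
  shows "|{t. wf_trm L t \<and> trm_vars t \<subseteq> I}| \<le>o |S|"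
proof -
  have LS: "|L| \<le>o |S|"
    using L S by (rule countable_ordLeq)
  \<comment> \<open>Stage \<open>n\<close> contains all well-formed terms of depth at most
    \<open>n\<close>. Arities are ignored, as only an upper bound is wanted.\<close>
  define T where "T = rec_nat (Var ` I) (\<lambda>_ T. T \<union> (\<lambda>(p, ts). App (fst p) ts) ` (L \<times> lists T))"
  have T0: "T 0 = Var ` I" and TS: "T (Suc n) = T n \<union> (\<lambda>(p, ts). App (fst p) ts) ` (L \<times> lists (T n))" for n
    by (simp_all add: T_def)
  have mono: "T m \<subseteq> T n" if "m \<le> n" for m n
    using that by (induction rule: dec_induct) (auto simp: TS)
  have "|T n| \<le>o |S|" for n
  proof (induction n)
    case 0
    then show ?case
      unfolding T0 using card_of_image I ordLeq_transitive by blast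
  next
    case (Suc n)
    have "|L \<times> lists (T n)| \<le>o |S|"
      using LS card_of_lists_ordLeq[OF S Suc] S
      by (intro card_of_Times_ordLeq_infinite_Field[where r = "|S|"]) (auto simp: card_of_card_order_on Field_card_of)
    then have "|(\<lambda>(p, ts). App (fst p) ts) ` (L \<times> lists (T n))| \<le>o |S|"
      using card_of_image ordLeq_transitive by blast
    then show ?case
      unfolding TS using Suc S
      by (intro card_of_Un_ordLeq_infinite_Field[where r = "|S|"]) (auto simp: card_of_card_order_on Field_card_of)
  qed
  moreover have "|UNIV :: nat set| \<le>o |S|"
    using S infinite_iff_card_of_nat by blast
  ultimately have "|\<Union>n. T n| \<le>o |S|"
    using card_of_UNION_ordLeq_infinite[OF S, of "UNIV :: nat set" T] by simp
  moreover have "t \<in> (\<Union>n. T n)" if "wf_trm L t" "trm_vars t \<subseteq> I" for t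
    using that
  proof (induction t)
    case (Var x)
    then show ?case
      using T0 by auto
  next
    case (App f ts)
    then have "set ts \<subseteq> (\<Union>n. T n)"
      by (auto simp: list_all_iff SUP_le_iff)
    then obtain n where "set ts \<subseteq> T n"
      using finite_chain_bound[of "set ts" T] mono by auto
    then have "App f ts \<in> T (Suc n)"
      using App.prems by (force simp: TS image_iff)
    then show ?case
      by blast
  qed
  then have "{t. wf_trm L t \<and> trm_vars t \<subseteq> I} \<subseteq> (\<Union>n. T n)"
    by blast
  ultimately show ?thesis
    using card_of_mono1 ordLeq_transitive by blast
qed

text \<open>Only finitely many variables occur in \<open>t\<close> and \<open>s\<close>, so infinite
  rank leaves room to rename them to distinct basis elements of \<open>B\<close>. A homomorphism to
  \<open>A\<close> sends these to the values under \<open>g\<close> and carries the identity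
  along.\<close>

lemma identity_from_infinite_free:
  assumes V: "variety L V" and B: "freely_generated L V B X" and X: "infinite X"
    and A: "A \<in> V" and g: "g ` trm_vars t \<subseteq> carrier A" "g ` trm_vars s \<subseteq> carrier A"
    and wf: "wf_trm L t" "wf_trm L s"
    and eq: "\<And>v. range v \<subseteq> carrier B \<Longrightarrow> eval_trm B v t = eval_trm B v s"
  shows "eval_trm A g t = eval_trm A g s"
proof -
  let ?W = "trm_vars t \<union> trm_vars s"
  have a0: "eval_trm A g t \<in> carrier A"
    using variety_structure[OF V A] wf g by (intro eval_trm_in_carrier)
  obtain f where f: "inj (f :: nat \<Rightarrow> _)" "range f \<subseteq> X"
    using X infinite_countable_subset by blast
  obtain i where "inj_on (i :: _ \<Rightarrow> nat) ?W"
    using finite_imp_inj_to_nat_seg[of ?W] finite_trm_vars[of t] finite_trm_vars[of s] by auto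
  then have inj: "inj_on (f \<circ> i) ?W"
    using f(1) by (intro comp_inj_on) (auto intro: inj_on_subset)
  have range: "range (f \<circ> i) \<subseteq> X"
    using f(2) by auto
  have g': "g w \<in> carrier A" if "w \<in> ?W" for w
    using that g by auto
  \<comment> \<open>The inverse of the renaming recovers the variable. All other basis elements go
    to the value of \<open>t\<close>, chosen only because it is known to lie in
    \<open>A\<close>.\<close>
  have "(\<lambda>x. if x \<in> (f \<circ> i) ` ?W then g (inv_into ?W (f \<circ> i) x) else eval_trm A g t) ` X \<subseteq> carrier A"
  proof (intro image_subsetI)
    fix x
    show "(if x \<in> (f \<circ> i) ` ?W then g (inv_into ?W (f \<circ> i) x) else eval_trm A g t) \<in> carrier A"
      using a0 g'[OF inv_into_into[of x "f \<circ> i" ?W]] by presburger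
  qed
  from freely_generated_extend[OF B A this] obtain h where h: "hom L B A h"
    "\<And>x. x \<in> X \<Longrightarrow> h x = (if x \<in> (f \<circ> i) ` ?W then g (inv_into ?W (f \<circ> i) x) else eval_trm A g t)"
    by blast
  have hw: "h ((f \<circ> i) w) = g w" if "w \<in> ?W" for w
    using that h(2)[of "(f \<circ> i) w"] range inv_into_f_f[OF inj that] by auto
  have fB: "range (f \<circ> i) \<subseteq> carrier B"
    using range freely_generatedD(2)[OF B] by auto
  have "eval_trm A g u = h (eval_trm B (f \<circ> i) u)" if "wf_trm L u" "trm_vars u \<subseteq> ?W" for u
  proof -
    have "(f \<circ> i) ` trm_vars u \<subseteq> carrier B"
      using fB by auto
    then have "h (eval_trm B (f \<circ> i) u) = eval_trm A (\<lambda>w. h ((f \<circ> i) w)) u"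
      using eval_trm_hom[OF h(1) that(1), of "f \<circ> i"] by simp
    also have "\<dots> = eval_trm A g u"
      using hw that(2) by (intro eval_trm_cong) auto
    finally show ?thesis
      by simp
  qed
  then show ?thesis
    using eq[OF fB] wf by simp
qed

text \<open>
  The free algebra consists of codes in \<open>'u\<close> for the term functions on \<open>B\<close>; this suffices
  because a free algebra of infinite rank satisfies only the identities of the variety.
\<close>

lemma free_algebra_exists:
  fixes L :: "('f \<times> nat) set" and V :: "('f, 'u) alg set" and I :: "'v set" and S :: "'u set"
  assumes V: "variety L V" and L: "countable L"
    and B: "freely_generated L V B X" and X: "infinite X"
    and S: "infinite S" "small S" and I: "|I| \<le>o |S|"
  obtains F e where "freely_generated L V F (e ` I)" "inj_on e I" "|carrier F| \<le>o |S|"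
proof -
  define T :: "('f, 'v) trm set" where "T = {t. wf_trm L t \<and> trm_vars t \<subseteq> I}"
  \<comment> \<open>Cutting off the assignments that leave \<open>B\<close> makes
    \<open>ev t = ev s\<close> say exactly that the identity holds in \<open>B\<close>. The map
    \<open>j\<close> below codes these functions by elements of \<open>S\<close>.\<close>
  define ev :: "('f, 'v) trm \<Rightarrow> ('v \<Rightarrow> 'u) \<Rightarrow> 'u" where
    "ev t = (\<lambda>v. if range v \<subseteq> carrier B then eval_trm B v t else undefined)" for t
  have "|ev ` T| \<le>o |S|"
    using card_of_trms_ordLeq[OF S(1) I L] card_of_image ordLeq_transitive unfolding T_def by blast
  then obtain j where j: "inj_on j (ev ` T)" "j ` ev ` T \<subseteq> S"
    unfolding card_of_ordLeq[symmetric] by blast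
  define q where "q t = j (ev t)" for t
  have q_eq: "q t = q s \<longleftrightarrow> (\<forall>v. range v \<subseteq> carrier B \<longrightarrow> eval_trm B v t = eval_trm B v s)"
    if "t \<in> T" "s \<in> T" for t s
  proof -
    have "q t = q s \<longleftrightarrow> ev t = ev s"
      using j(1) that by (auto simp: q_def inj_on_def)
    also have "\<dots> \<longleftrightarrow> (\<forall>v. range v \<subseteq> carrier B \<longrightarrow> eval_trm B v t = eval_trm B v s)"
      by (auto simp: ev_def fun_eq_iff)
    finally show ?thesis .
  qed
  define r where "r = inv_into T q"
  have rT: "r x \<in> T" and qr: "q (r x) = x" if "x \<in> q ` T" for x
    using that by (auto simp: r_def inv_into_into f_inv_into_f)
  define F :: "('f, 'u) alg" where "F = \<lparr>carrier = q ` T, interp = (\<lambda>f xs.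
    if (f, length xs) \<in> L \<and> set xs \<subseteq> q ` T then q (App f (map r xs)) else undefined)\<rparr>"
  have cF: "carrier F = q ` T"
    by (simp add: F_def)
  have iF: "interp F f xs = q (App f (map r xs))" if "(f, length xs) \<in> L" "set xs \<subseteq> q ` T" for f xs
    using that by (simp add: F_def)
  have AppT: "App f (map r xs) \<in> T" if "(f, length xs) \<in> L" "set xs \<subseteq> q ` T" for f xs
  proof -
    have "r x \<in> T" if "x \<in> set xs" for x
      using that \<open>set xs \<subseteq> q ` T\<close> by (auto intro!: rT)
    then show ?thesis
      using that by (auto simp: T_def list_all_iff)
  qed
  have cS: "carrier F \<subseteq> S"
    using j(2) by (auto simp: cF q_def)
  have sF: "is_structure L F"
    unfolding is_structure_def
  proof (intro conjI allI)
    show "small (carrier F)"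
      using S(2) cS by (rule small_subset)
    show "if (f, length xs) \<in> L \<and> set xs \<subseteq> carrier F then interp F f xs \<in> carrier F
        else interp F f xs = undefined" for f xs
      using AppT[of f xs] by (simp add: F_def)
  qed
  \<comment> \<open>The premise \<open>eq\<close> makes evaluation independent of the representative
    chosen by \<open>r\<close>. It is applied with \<open>A = B\<close> to separate points, and then
    to every algebra of the variety.\<close>
  have ev_hom: "hom L F A (\<lambda>x. eval_trm A g (r x))"
    if A: "A \<in> V" and g: "g ` I \<subseteq> carrier A" and
      eq: "\<And>t s. t \<in> T \<Longrightarrow> s \<in> T \<Longrightarrow> q t = q s \<Longrightarrow> eval_trm A g t = eval_trm A g s" for A g
    unfolding hom_def
  proof (intro conjI allI impI)
    have "eval_trm A g t \<in> carrier A" if "t \<in> T" for t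
      using that g variety_structure[OF V A] by (intro eval_trm_in_carrier) (auto simp: T_def)
    then show "(\<lambda>x. eval_trm A g (r x)) ` carrier F \<subseteq> carrier A"
      using rT by (auto simp: cF)
    fix f xs assume "(f, length xs) \<in> L \<and> set xs \<subseteq> carrier F"
    then have *: "(f, length xs) \<in> L" "set xs \<subseteq> q ` T"
      by (auto simp: cF)
    have "eval_trm A g (r (interp F f xs)) = eval_trm A g (App f (map r xs))"
      using AppT[OF *] iF[OF *] by (intro eq) (auto intro: rT qr)
    then show "eval_trm A g (r (interp F f xs)) = interp A f (map (\<lambda>x. eval_trm A g (r x)) xs)"
      by (simp add: comp_def)
  qed (use sF variety_structure[OF V A] in auto)
  have FV: "F \<in> V"
  proof (rule variety_separated[OF V sF])
    fix x y assume xy: "x \<in> carrier F" "y \<in> carrier F" "x \<noteq> y"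
    then have T: "r x \<in> T" "r y \<in> T" and "q (r x) \<noteq> q (r y)"
      using rT qr by (auto simp: cF)
    then obtain v where v: "range v \<subseteq> carrier B" "eval_trm B v (r x) \<noteq> eval_trm B v (r y)"
      using q_eq[OF T] by blast
    have "v ` I \<subseteq> carrier B"
      using v(1) by auto
    then have "hom L F B (\<lambda>x. eval_trm B v (r x))"
      using q_eq v(1) by (intro ev_hom freely_generatedD(1)[OF B]) auto
    then show "\<exists>D\<in>V. \<exists>h. hom L F D h \<and> h x \<noteq> h y"
      using v(2) freely_generatedD(1)[OF B] by blast
  qed
  have VarT: "Var i \<in> T" if "i \<in> I" for i
    using that by (simp add: T_def)
  have gen: "q t \<in> closure_in L F ((\<lambda>i. q (Var i)) ` I)" if "wf_trm L t" "trm_vars t \<subseteq> I" for t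
    using that
  proof (induction t)
    case (Var i)
    then show ?case
      by (auto intro: closure_in.base)
  next
    case (App f ts)
    have L: "(f, length (map q ts)) \<in> L" and T: "set ts \<subseteq> T" "App f ts \<in> T"
      using App.prems by (auto simp: T_def list_all_iff)
    have sub: "set (map q ts) \<subseteq> q ` T"
      using T(1) by auto
    have "interp F f (map q ts) \<in> closure_in L F ((\<lambda>i. q (Var i)) ` I)"
      using App L by (intro closure_in_closed[OF L]) (auto simp: list_all_iff SUP_le_iff)
    moreover have "interp F f (map q ts) = q (App f (map r (map q ts)))"
      using L sub by (rule iF)
    moreover have "q (App f (map r (map q ts))) = q (App f ts)"
      unfolding q_eq[OF AppT[OF L sub] T(2)]
    proof (intro allI impI)
      fix v :: "'v \<Rightarrow> 'u" assume v: "range v \<subseteq> carrier B"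
      have "eval_trm B v (r (q t)) = eval_trm B v t" if "t \<in> set ts" for t
      proof -
        have "t \<in> T"
          using that T(1) by auto
        then show ?thesis
          using q_eq[OF rT \<open>t \<in> T\<close>, of "q t"] qr[of "q t"] v by auto
      qed
      then have "map (eval_trm B v) (map r (map q ts)) = map (eval_trm B v) ts"
        by auto
      then show "eval_trm B v (App f (map r (map q ts))) = eval_trm B v (App f ts)"
        by (simp only: eval_trm.simps)
    qed
    ultimately show ?case
      by simp
  qed
  have "freely_generated L V F ((\<lambda>i. q (Var i)) ` I)"
  proof (rule freely_generatedI[OF V FV])
    show "(\<lambda>i. q (Var i)) ` I \<subseteq> carrier F"
      using VarT by (auto simp: cF)
    show "carrier F \<subseteq> closure_in L F ((\<lambda>i. q (Var i)) ` I)"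
      using gen by (auto simp: cF T_def)
    fix A g assume A: "A \<in> V" "g ` (\<lambda>i. q (Var i)) ` I \<subseteq> carrier A"
    define g' where "g' i = g (q (Var i))" for i
    have g': "g' ` I \<subseteq> carrier A"
      using A(2) by (auto simp: g'_def)
    have eq: "eval_trm A g' t = eval_trm A g' s" if "t \<in> T" "s \<in> T" "q t = q s" for t s
    proof (rule identity_from_infinite_free[OF V B X A(1)])
      show "g' ` trm_vars t \<subseteq> carrier A" "g' ` trm_vars s \<subseteq> carrier A"
        using that g' unfolding T_def by blast+
    qed (use that q_eq[OF that(1,2)] in \<open>auto simp: T_def\<close>)
    have "eval_trm A g' (r (q (Var i))) = g (q (Var i))" if "i \<in> I" for i
      using eq[of "r (q (Var i))" "Var i"] rT[of "q (Var i)"] qr[of "q (Var i)"] VarT[OF that]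
      by (simp add: g'_def)
    then show "\<exists>h. hom L F A h \<and> (\<forall>x\<in>(\<lambda>i. q (Var i)) ` I. h x = g x)"
      using ev_hom[OF A(1) g' eq] by blast
  qed
  moreover have "inj_on (\<lambda>i. q (Var i)) I"
  proof (rule inj_onI, rule ccontr)
    fix i k assume *: "i \<in> I" "k \<in> I" "q (Var i) = q (Var k)" "i \<noteq> k"
    \<comment> \<open>Two distinct basis elements of \<open>B\<close> provide an assignment under
      which the variables \<open>i\<close> and \<open>k\<close> take different values.\<close>
    obtain x where x: "x \<in> X"
      using X by fastforce
    obtain y where y: "y \<in> X" "y \<noteq> x"
      using infinite_imp_nonempty[OF infinite_remove[OF X, of x]] by blast
    have "range (\<lambda>k. if k = i then x else y) \<subseteq> carrier B"
      using x y freely_generatedD(2)[OF B] by auto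
    then show False
      using q_eq[OF VarT VarT, OF *(1,2)] * y(2) by fastforce
  qed
  moreover have "|carrier F| \<le>o |S|"
    using cS by (rule card_of_mono1)
  ultimately show thesis
    using that by blast
qed

section \<open>Isomorphic copies with prescribed values\<close>

lemma card_of_Compl_small:
  assumes "infinite (UNIV :: 'u set)" and "small (Y :: 'u set)"
  shows "|UNIV :: 'u set| \<le>o |- Y|"
proof (rule ccontr)
  assume "\<not> ?thesis"
  then have "|- Y| <o |UNIV :: 'u set|"
    by (simp add: not_ordLeq_iff_ordLess[OF card_of_Well_order card_of_Well_order])
  then have "|Y \<union> - Y| <o |UNIV :: 'u set|"
    using assms by (intro card_of_Un_ordLess_infinite) (auto simp: small_def)
  then show False
    using ordLess_irreflexive by (metis Compl_partition)
qed

text \<open>The complement of a small set has the size of the universe, so the elements outside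
  \<open>X\<close> can be renamed injectively away from the prescribed values. This turns embeddings
  into inclusions.\<close>

lemma iso_extension:
  fixes D :: "('f, 'u) alg"
  assumes "infinite (UNIV :: 'u set)" and D: "is_structure L D"
    and X: "X \<subseteq> carrier D" "inj_on g X"
  obtains D' h where "iso L D D' h" "\<And>x. x \<in> X \<Longrightarrow> h x = g x"
proof -
  have "small (g ` X)"
    using small_subset[OF structure_small[OF D] X(1)] card_of_image ordLeq_ordLess_trans
    unfolding small_def by blast
  then have "|UNIV :: 'u set| \<le>o |- (g ` X)|"
    using assms(1) by (intro card_of_Compl_small)
  then have "|carrier D - X| \<le>o |- (g ` X)|"
    using card_of_mono1[of "carrier D - X" UNIV] ordLeq_transitive by blast
  then obtain j where j: "inj_on j (carrier D - X)" "j ` (carrier D - X) \<subseteq> - (g ` X)"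
    unfolding card_of_ordLeq[symmetric] by blast
  let ?h = "\<lambda>x. if x \<in> X then g x else j x"
  have "inj_on ?h (carrier D)"
    using j X(2) by (auto simp: inj_on_def)
  then show thesis
    using iso_copy_exists[OF D] that[of _ ?h] by fastforce
qed

section \<open>Moving elements by automorphisms\<close>

text \<open>For \<open>f\<close> injective on \<open>A\<close> and \<open>A\<close> disjoint from
  its image, this is the involution exchanging the two; applied to a basis it induces an
  automorphism.\<close>

definition swap_along :: "('a \<Rightarrow> 'a) \<Rightarrow> 'a set \<Rightarrow> 'a \<Rightarrow> 'a" where
  "swap_along f A x = (if x \<in> A then f x else if x \<in> f ` A then inv_into A f x else x)"

lemma swap_along_simps:
  assumes "inj_on f A" "A \<inter> f ` A = {}"
  shows "x \<in> A \<Longrightarrow> swap_along f A x = f x" "x \<in> A \<Longrightarrow> swap_along f A (f x) = x"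
    "x \<notin> A \<Longrightarrow> x \<notin> f ` A \<Longrightarrow> swap_along f A x = x"
  using assms by (auto simp: swap_along_def)

lemma swap_along_involution:
  assumes "inj_on f A" "A \<inter> f ` A = {}"
  shows "swap_along f A (swap_along f A x) = x"
  using swap_along_simps[OF assms] by (cases "x \<in> A \<union> f ` A") auto

lemma swap_along_bij:
  assumes "inj_on f A" "A \<inter> f ` A = {}" "A \<subseteq> X" "f ` A \<subseteq> X"
  shows "bij_betw (swap_along f A) X X"
proof (rule bij_betw_byWitness[where f' = "swap_along f A"])
  have "swap_along f A x \<in> X" if "x \<in> X" for x
    using that assms(3,4) swap_along_simps[OF assms(1,2)] by (cases "x \<in> A \<union> f ` A") auto
  then show "swap_along f A ` X \<subseteq> X" "swap_along f A ` X \<subseteq> X"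
    by auto
qed (use swap_along_involution[OF assms(1,2)] in auto)

text \<open>The endomorphism that sends \<open>x\<close> to \<open>x'\<close> and fixes the other
  basis elements would fix everything generated by \<open>Y\<close>, including
  \<open>x\<close>.\<close>

lemma basis_element_not_generated:
  assumes V: "variety L V" and F: "freely_generated L V F X"
    and Y: "Y \<subseteq> X" and x: "x \<in> X - Y" "x' \<in> X - Y" "x \<noteq> x'"
  shows "x \<notin> closure_in L F Y"
proof
  assume xY: "x \<in> closure_in L F Y"
  have XF: "X \<subseteq> carrier F" and FV: "F \<in> V"
    using freely_generatedD[OF F] by auto
  have "(\<lambda>y. if y = x then x' else y) ` X \<subseteq> carrier F"
    using x XF by auto
  from freely_generated_extend[OF F FV this] obtain h
    where h: "hom L F F h" "\<And>y. y \<in> X \<Longrightarrow> h y = (if y = x then x' else y)"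
    by blast
  have "h x = id x"
    using x Y XF h(2)
    by (intro hom_eq_on_closure_in[OF h(1) hom_inclusion[OF substructure_refl] _ _ xY])
      (auto intro: variety_structure[OF V FV])
  then show False
    using h(2) x by auto
qed

text \<open>
  The finitely many elements of \<open>Y - P\<close> on which \<open>b\<close> depends are exchanged with elements of
  \<open>Z\<close> that occur neither in \<open>C\<close> nor in the countable set \<open>T\<close> of possible values.  Collapsing
  the latter elements to a point of \<open>P\<close> then leaves the image of \<open>b\<close> unchanged.
\<close>

lemma generated_if_countable_orbit:
  assumes V: "variety L V" and N: "freely_generated L V N Y" and NM: "substructure L N M"
    and ext: "\<And>k. automorphism L N k \<Longrightarrow> \<exists>g. automorphism L M g \<and> (\<forall>x \<in> carrier N. g x = k x)"
    and P: "P \<subseteq> Y" "P \<noteq> {}" "P \<inter> Z = {}" and Z: "Z \<subseteq> Y" "uncountable Z"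
    and b: "b \<in> closure_in L N (Y - Z)"
    and C: "C \<subseteq> Z" "countable C" and T: "countable T"
    and orbit: "\<And>g. automorphism L M g \<Longrightarrow> (\<And>x. x \<in> P \<union> C \<Longrightarrow> g x = x) \<Longrightarrow> g b \<in> T"
  shows "b \<in> closure_in L N P"
proof -
  have sN: "is_structure L N" and YN: "Y \<subseteq> carrier N" and cN: "carrier N = closure_in L N Y"
    using freely_generated_structure[OF V N] freely_generatedD[OF N] by auto
  obtain W0 where W0: "finite W0" "W0 \<subseteq> Y - Z" "b \<in> closure_in L N W0"
    using closure_in_finitary[OF b] by blast
  define W where "W = W0 - P"
  have W: "finite W" "W \<subseteq> Y - Z - P" "b \<in> closure_in L N (P \<union> W)"
    using W0 closure_in_mono[of W0 "P \<union> W" L N] by (auto simp: W_def)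
  have "\<forall>t \<in> T \<inter> carrier N. \<exists>R. finite R \<and> R \<subseteq> Y \<and> t \<in> closure_in L N R"
    using closure_in_finitary[of _ L N Y] cN by blast
  then obtain r where r: "\<And>t. t \<in> T \<inter> carrier N \<Longrightarrow> finite (r t) \<and> r t \<subseteq> Y \<and> t \<in> closure_in L N (r t)"
    by metis
  \<comment> \<open>\<open>R\<close> collects finite supports of the possible values. Being
    countable, it leaves infinitely many fresh elements in the uncountable \<open>Z\<close>.\<close>
  define R where "R = (\<Union>t \<in> T \<inter> carrier N. r t)"
  have "countable R"
    unfolding R_def using T r by (intro countable_UN) (auto intro: countable_finite)
  then have "infinite (Z - (C \<union> R))"
    using Z(2) C(2) by (metis countable_Un uncountable_infinite uncountable_minus_countable)
  then obtain W' where W': "finite W'" "card W' = card W" "W' \<subseteq> Z - (C \<union> R)"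
    using infinite_arbitrarily_large by blast
  obtain f where f: "bij_betw f W W'"
    using finite_same_card_bij[OF W(1) W'(1)] W'(2) by auto
  have fW: "inj_on f W" "f ` W = W'" "W \<inter> f ` W = {}"
    using f W(2) W'(3) by (auto simp: bij_betw_def)
  let ?\<pi> = "swap_along f W"
  have W'Y: "W' \<subseteq> Y" "P \<inter> W' = {}"
    using W'(3) Z P by auto
  have "bij_betw ?\<pi> Y Y"
    using W W'Y(1) fW by (intro swap_along_bij) auto
  from freely_generated_bij[OF V N N this] obtain k
    where k: "automorphism L N k" "\<And>x. x \<in> Y \<Longrightarrow> k x = ?\<pi> x"
    by blast
  obtain g where g: "automorphism L M g" "\<And>x. x \<in> carrier N \<Longrightarrow> g x = k x"
    using ext[OF k(1)] by blast
  have kP: "k x = x" if "x \<in> P" for x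
  proof -
    have "x \<in> Y" "x \<notin> W" "x \<notin> f ` W"
      using that P W W'Y fW(2) by auto
    then show ?thesis
      using k(2) swap_along_simps(3)[OF fW(1,3)] by simp
  qed
  have kW: "k ` (P \<union> W) \<subseteq> P \<union> W'"
    using kP k(2) swap_along_simps(1)[OF fW(1,3)] fW(2) W by auto
  have bN: "b \<in> carrier N"
    using b closure_in_mono[of "Y - Z" Y L N] cN by auto
  have kbN: "k b \<in> carrier N"
    using homD(4)[OF isoD(1)[OF k(1)]] bN .
  \<comment> \<open>The exchange moves only \<open>W\<close>, which lies outside \<open>P\<close>
    and \<open>Z\<close>, and \<open>W'\<close>, which lies inside \<open>Z\<close> but avoids
    \<open>C\<close>; hence \<open>P\<close> and \<open>C\<close> stay fixed.\<close>
  have "g b \<in> T"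
  proof (rule orbit[OF g(1)])
    fix x assume x: "x \<in> P \<union> C"
    then have xY: "x \<in> Y"
      using P C Z by auto
    have "x \<notin> W" "x \<notin> f ` W"
      using x W W' fW(2) P(3) C(1) by blast+
    then have "k x = x"
      using k(2)[OF xY] swap_along_simps(3)[OF fW(1,3)] by simp
    then show "g x = x"
      using g(2) xY YN by auto
  qed
  then have kbT: "k b \<in> T \<inter> carrier N"
    using g(2) bN kbN by auto
  obtain p where p: "p \<in> P"
    using P(2) by auto
  have "(\<lambda>x. if x \<in> W' then p else x) ` Y \<subseteq> carrier N"
    using p P YN by auto
  from freely_generated_extend[OF N freely_generatedD(1)[OF N] this] obtain \<rho>
    where \<rho>: "hom L N N \<rho>" "\<And>x. x \<in> Y \<Longrightarrow> \<rho> x = (if x \<in> W' then p else x)"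
    by blast
  have idN: "hom L N N id"
    using hom_inclusion[OF substructure_refl[OF sN]] .
  have "\<rho> (k b) = id (k b)"
  proof (rule hom_eq_on_closure_in[OF \<rho>(1) idN])
    show "k b \<in> closure_in L N (r (k b))" "r (k b) \<subseteq> carrier N"
      using r[OF kbT] YN by auto
    fix x assume "x \<in> r (k b)"
    then have "x \<in> Y" "x \<notin> W'"
      using r[OF kbT] W'(3) kbT by (auto simp: R_def)
    then show "\<rho> x = id x"
      using \<rho>(2) by simp
  qed
  moreover have "k b \<in> closure_in L N (P \<union> W')"
  proof -
    have "k b \<in> k ` closure_in L N (P \<union> W)"
      using W(3) by auto
    also have "\<dots> = closure_in L N (k ` (P \<union> W))"
      using P W YN by (intro hom_image_closure_in[OF isoD(1)[OF k(1)]]) auto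
    also have "\<dots> \<subseteq> closure_in L N (P \<union> W')"
      using kW by (rule closure_in_mono)
    finally show ?thesis .
  qed
  moreover have "\<rho> ` closure_in L N (P \<union> W') \<subseteq> closure_in L N P"
  proof -
    have "\<rho> ` closure_in L N (P \<union> W') = closure_in L N (\<rho> ` (P \<union> W'))"
      using P W'Y YN by (intro hom_image_closure_in[OF \<rho>(1)]) auto
    moreover have "\<rho> ` (P \<union> W') \<subseteq> P"
    proof (rule image_subsetI)
      fix x assume "x \<in> P \<union> W'"
      then show "\<rho> x \<in> P"
        using \<rho>(2)[of x] P(1) W'Y p by auto
    qed
    ultimately show ?thesis
      using closure_in_mono[of "\<rho> ` (P \<union> W')" P L N] by simp
  qed
  ultimately have kbP: "k b \<in> closure_in L N P"
    by (metis id_apply image_subset_iff)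
  \<comment> \<open>As \<open>k\<close> fixes \<open>P\<close> pointwise, it fixes
    \<open>k b\<close>, and injectivity gives \<open>k b = b\<close>.\<close>
  have "k (k b) = id (k b)"
    using kP P YN by (intro hom_eq_on_closure_in[OF isoD(1)[OF k(1)] idN _ _ kbP]) auto
  then have "k b = b"
    using isoD(3)[OF k(1)] bN kbN by (auto simp: inj_on_def)
  then show ?thesis
    using kbP by simp
qed

section \<open>Quantifier-free definable closure\<close>

lemma finite_qf_vars: "finite (qf_vars \<phi>)"
  by (induction \<phi>) (auto simp: finite_trm_vars)

lemma dcl_qf_extensive:
  assumes "C \<subseteq> carrier M"
  shows "C \<subseteq> dcl_qf L M C"
proof
  fix c assume "c \<in> C"
  then show "c \<in> dcl_qf L M C"
    unfolding dcl_qf_def using assms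
    by (intro CollectI conjI exI[of _ "Eq (Var None) (Var (Some c))"]) auto
qed

text \<open>A defining formula mentions finitely many parameters, and an automorphism fixing them
  preserves its solution set, here a singleton.\<close>

lemma dcl_qf_fixed:
  fixes L :: "('f \<times> nat) set" and M :: "('f, 'u) alg"
  assumes b: "b \<in> dcl_qf L M C" and C: "C \<subseteq> carrier M"
  obtains C0 where "finite C0" "C0 \<subseteq> C"
    "\<And>g. automorphism L M g \<Longrightarrow> (\<And>c. c \<in> C0 \<Longrightarrow> g c = c) \<Longrightarrow> g b = b"
proof -
  obtain \<phi> :: "('f, 'u option) qf" where bM: "b \<in> carrier M" and \<phi>: "wf_qf L \<phi>" "qf_vars \<phi> \<subseteq> insert None (Some ` C)"
    "{x \<in> carrier M. sat M (case_option x (\<lambda>c. c)) \<phi>} = {b}"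
    using b unfolding dcl_qf_def by blast
  have "g b = b" if g: "automorphism L M g" "\<And>c. Some c \<in> qf_vars \<phi> \<Longrightarrow> g c = c" for g
  proof -
    have "case_option b (\<lambda>c. c) ` qf_vars \<phi> \<subseteq> carrier M"
    proof (rule image_subsetI)
      fix x assume "x \<in> qf_vars \<phi>"
      then have "x \<in> insert None (Some ` C)"
        using \<phi>(2) by blast
      then show "case_option b (\<lambda>c. c) x \<in> carrier M"
        using bM C by auto
    qed
    then have "sat M (\<lambda>x. g (case_option b (\<lambda>c. c) x)) \<phi>"
      using sat_iso[OF g(1) \<phi>(1)] \<phi>(3) by blast
    moreover have "sat M (\<lambda>x. g (case_option b (\<lambda>c. c) x)) \<phi> = sat M (case_option (g b) (\<lambda>c. c)) \<phi>"
      using g(2) by (intro sat_cong) (auto split: option.split)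
    moreover have "g b \<in> carrier M"
      using homD(4)[OF isoD(1)[OF g(1)] bM] .
    ultimately show ?thesis
      using \<phi>(3) by blast
  qed
  moreover have "finite {c. Some c \<in> qf_vars \<phi>}"
    using finite_vimageI[OF finite_qf_vars[of \<phi>], of Some] by (simp add: vimage_def)
  moreover have "{c. Some c \<in> qf_vars \<phi>} \<subseteq> C"
    using \<phi>(2) by auto
  ultimately show thesis
    by (intro that[of "{c. Some c \<in> qf_vars \<phi>}"]) auto
qed

section \<open>Strong substructures\<close>

lemma AEC_D:
  assumes "AEC L K le"
  shows "le A B \<Longrightarrow> A \<in> K" "le A B \<Longrightarrow> B \<in> K" "A \<in> K \<Longrightarrow> is_structure L A"
    "A \<in> K \<Longrightarrow> iso L A B h \<Longrightarrow> B \<in> K"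
    "le A B \<Longrightarrow> iso L B B' h \<Longrightarrow> iso L A A' h \<Longrightarrow> le A' B'"
    "le A B \<Longrightarrow> substructure L A B"
    "A \<in> K \<Longrightarrow> le A A"
    "le A B \<Longrightarrow> le B C \<Longrightarrow> le A C"
    "le A C \<Longrightarrow> le B C \<Longrightarrow> substructure L A B \<Longrightarrow> le A B"
proof -
  show "le A C \<Longrightarrow> le B C \<Longrightarrow> substructure L A B \<Longrightarrow> le A B"
    using assms unfolding AEC_def by meson
  show "le A B \<Longrightarrow> iso L B B' h \<Longrightarrow> iso L A A' h \<Longrightarrow> le A' B'"
    using assms unfolding AEC_def by meson
  show "A \<in> K \<Longrightarrow> iso L A B h \<Longrightarrow> B \<in> K"
    using assms unfolding AEC_def by meson
  show "le A B \<Longrightarrow> le B C \<Longrightarrow> le A C"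
    using assms unfolding AEC_def by meson
  show "le A B \<Longrightarrow> A \<in> K" "le A B \<Longrightarrow> B \<in> K" "A \<in> K \<Longrightarrow> is_structure L A"
    "le A B \<Longrightarrow> substructure L A B" "A \<in> K \<Longrightarrow> le A A"
    using assms unfolding AEC_def by meson+
qed

lemma AEC_chain:
  assumes "AEC L K le" "continuous_chain L K le r N" "is_union L (N ` Field r) U" "B \<in> K"
    and "\<And>i. i \<in> Field r \<Longrightarrow> le (N i) B"
  shows "le U B"
  using assms unfolding AEC_def by meson

text \<open>Chains are indexed by well-orders on subsets of \<open>'u\<close>, so omega is first
  copied into \<open>'u\<close> along an injection \<open>\<iota>\<close>. Coherence makes the
  stages a strong chain, since all of them are strong in \<open>B\<close>.\<close>

lemma AEC_omega_chain:
  fixes L :: "('f \<times> nat) set" and N :: "nat \<Rightarrow> ('f, 'u) alg"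
  assumes AEC: "AEC L K le" and U: "natLeq <o |UNIV :: 'u set|"
    and N: "\<And>n. le (N n) B" and mono: "\<And>m n. m \<le> n \<Longrightarrow> carrier (N m) \<subseteq> carrier (N n)"
    and UB: "substructure L U B" and cU: "carrier U = (\<Union>n. carrier (N n))"
  shows "le U B"
proof -
  have "infinite (UNIV :: 'u set)"
    using U by (metis Field_natLeq card_of_ordLeq_finite infinite_UNIV_nat ordLess_imp_ordLeq
      ordIso_ordLeq_trans card_of_nat)
  then obtain \<iota> :: "nat \<Rightarrow> 'u" where \<iota>: "inj \<iota>"
    using infinite_countable_subset by blast
  define r where "r = dir_image natLeq \<iota>"
  have r: "(x, y) \<in> r \<longleftrightarrow> (\<exists>m n. x = \<iota> m \<and> y = \<iota> n \<and> m \<le> n)" for x y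
    by (auto simp: r_def dir_image_def natLeq_def)
  have wo: "Well_order r"
    unfolding r_def using natLeq_Well_order \<iota> by (intro Well_order_dir_image) (auto simp: Field_natLeq inj_on_def)
  have field: "Field r = range \<iota>"
    using dir_image_Field[of natLeq \<iota>] by (simp add: r_def Field_natLeq)
  have inv: "inv \<iota> (\<iota> n) = n" for n
    using \<iota> by simp
  have sub: "substructure L (N m) (N n)" if "m \<le> n" for m n
    using substructure_subset[OF AEC_D(6)[OF AEC N] AEC_D(6)[OF AEC N] mono[OF that]] .
  show ?thesis
  proof (rule AEC_chain[OF AEC, of r "\<lambda>x. N (inv \<iota> x)"])
    show "continuous_chain L K le r (\<lambda>x. N (inv \<iota> x))"
      unfolding continuous_chain_def
    proof (intro conjI allI impI ballI)
      show "Well_order r"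
        by (rule wo)
      show "Field r \<noteq> {}"
        by (simp add: field)
      have "|range \<iota>| \<le>o |UNIV :: nat set|"
        by (rule card_of_image)
      then show "small (Field r)"
        unfolding small_def field using U card_of_nat ordLeq_ordIso_trans ordLeq_ordLess_trans by blast
      show "N (inv \<iota> i) \<in> K" for i
        using AEC_D(1)[OF AEC N] .
      show "le (N (inv \<iota> i)) (N (inv \<iota> j))" if "(i, j) \<in> r" for i j
        using that AEC_D(9)[OF AEC N N sub] by (auto simp: r inv)
      fix i assume i: "limit_point r i"
      then obtain n where n: "i = \<iota> n"
        using field by (auto simp: limit_point_def)
      have under: "underS r i = \<iota> ` {..<n}"
        using \<iota> unfolding n underS_def r by (auto simp: inj_eq order_less_le)
      \<comment> \<open>No position in omega is a limit point: below \<open>n = Suc m\<close>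
        nothing lies strictly above \<open>m\<close>. Continuity of the chain is therefore
        vacuous.\<close>
      then have "n \<noteq> 0"
        using i by (auto simp: limit_point_def)
      then obtain m where m: "n = Suc m"
        using not0_implies_Suc by blast
      then have "\<iota> m \<in> underS r i"
        by (auto simp: under)
      then obtain k where k: "k \<in> underS r i" "\<iota> m \<in> underS r k"
        using i by (auto simp: limit_point_def)
      then obtain l where l: "k = \<iota> l" "l < n"
        by (auto simp: under)
      then have "m < l"
        using k(2) \<iota> by (auto simp: underS_def r inj_eq order_less_le)
      then show "is_union L ((\<lambda>x. N (inv \<iota> x)) ` underS r i) (N (inv \<iota> i))"
        using l(2) m by simp
    qed
    have "carrier (N n) \<subseteq> carrier U" for n
      using cU by auto
    then have "substructure L (N n) U" for n
      by (rule substructure_subset[OF AEC_D(6)[OF AEC N] UB])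
    then show "is_union L ((\<lambda>x. N (inv \<iota> x)) ` Field r) U"
      unfolding is_union_def field image_image using cU by (auto simp: inv)
    show "B \<in> K"
      using AEC_D(2)[OF AEC N] .
    show "le (N (inv \<iota> i)) B" for i
      by (rule N)
  qed
qed

text \<open>Infinite rank puts both algebras into \<open>K\<close>, where free factors are strong.
  The case \<open>Y = X\<close> leaves no complementary basis and is settled by reflexivity.\<close>

lemma strong_of_subbasis:
  assumes V: "variety L V" and cov: "AEC_covering L V K le"
    and F: "freely_generated L V F X" and Y: "Y \<subseteq> X" "infinite Y"
  shows "le (generated L F Y) F"
proof -
  have K: "free_algs_inf L V \<subseteq> K" and AEC: "AEC L K le"
    and ff: "\<And>A B. A \<in> free_algs L V \<inter> K \<Longrightarrow> B \<in> free_algs L V \<inter> K \<Longrightarrow> free_factor L V A B \<Longrightarrow> le A B"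
    using cov unfolding AEC_covering_def by blast+
  have "Y \<noteq> {}" "infinite X"
    using Y infinite_super by auto
  then have G: "freely_generated L V (generated L F Y) Y"
    using freely_generated_subset[OF V F Y(1)] by simp
  have "F \<in> free_algs L V \<inter> K" "generated L F Y \<in> free_algs L V \<inter> K"
    using F G Y(2) \<open>infinite X\<close> K unfolding free_algs_def free_algs_inf_def by auto
  then show ?thesis
    using ff free_factor_of_subbasis[OF V F _ \<open>Y \<noteq> {}\<close>] Y(1) AEC_D(7)[OF AEC]
      freely_generatedD(3)[OF F] by (metis IntE psubsetI)
qed

section \<open>A tree of realisations\<close>

lemma automorphism_conjugate_fixed:
  assumes H: "automorphism L M H" and g: "automorphism L M g"
    and fix_g: "g (H x) = H x" and x: "x \<in> carrier M"
  shows "(inv_into (carrier M) H \<circ> (g \<circ> H)) x = x"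
  using isoD(3)[OF H] fix_g x by simp

lemma least_difference:
  fixes f g :: "nat \<Rightarrow> 'a"
  assumes "f \<noteq> g"
  obtains m where "f m \<noteq> g m" "\<And>i. i < m \<Longrightarrow> f i = g i"
proof -
  have "\<exists>m. f m \<noteq> g m"
    using assms by auto
  then show thesis
    using that exists_least_iff[of "\<lambda>m. f m \<noteq> g m"] by blast
qed

text \<open>Here \<open>Y1\<close> is a basis of \<open>B\<close>, so \<open>N\<close> is the free
  product of \<open>B\<close> with the free algebra on \<open>Z\<close>. All of these algebras sit
  inside the monster model by inclusion.\<close>

locale RCP_in_monster =
  fixes L :: "('f \<times> nat) set" and V K :: "('f, 'u) alg set" and le :: "('f, 'u) strong_rel"
    and A B :: "('f, 'u) alg" and b0 :: 'u and a :: "nat \<Rightarrow> 'u"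
    and N M :: "('f, 'u) alg" and \<kappa> :: "'u rel" and Y1 :: "'u set" and Z :: "'u set"
  assumes natLeq_less: "natLeq <o |UNIV :: 'u set|"
    and V: "variety L V" and cov: "AEC_covering L V K le" and strong: "strong_enough L V K le"
    and witness: "RCP_witness L V A B b0"
    and inj_a: "inj a" and free_A: "freely_generated L V A (range a)"
    and factor: "\<And>i. free_factor L V (generated L B (a ` {..i})) B"
    and free_N: "freely_generated L V N (Y1 \<union> Z)" and disj: "Y1 \<inter> Z = {}"
    and inf_Y1: "infinite Y1" and uncountable_Z: "uncountable Z"
    and B_eq: "B = generated L N Y1"
    and monster: "monster L K le \<kappa> M" and le_NM: "le N M" and card_N: "|carrier N| <o \<kappa>"
begin

lemma AEC: "AEC L K le"
  using cov by (simp add: AEC_covering_def)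

lemma sub_AB: "substructure L A B"
  using witness by (simp add: RCP_witness_def)

lemma sN: "is_structure L N"
  using freely_generated_structure[OF V free_N] .

lemma basis_N: "Y1 \<subseteq> carrier N" "Z \<subseteq> carrier N"
  using freely_generatedD(2)[OF free_N] by auto

lemma sub_BN: "substructure L B N"
  unfolding B_eq using sN basis_N(1) by (rule substructure_generated)

lemma sub_AN: "substructure L A N"
  using sub_AB sub_BN by (rule substructure_trans)

lemma sub_NM: "substructure L N M"
  using AEC_D(6)[OF AEC le_NM] .

lemma sub_AM: "substructure L A M"
  using sub_AN sub_NM by (rule substructure_trans)

lemma M_in_K: "M \<in> K"
  using AEC_D(2)[OF AEC le_NM] .

lemma le_BM: "le B M"
proof -
  have "le B N"
    unfolding B_eq using strong_of_subbasis[OF V cov free_N _ inf_Y1] by simp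
  then show ?thesis
    using AEC_D(8)[OF AEC _ le_NM] by blast
qed

text \<open>RCP computes the closure in \<open>B\<close>, and the second clause of
  \<open>strong_enough\<close> transfers it to \<open>M\<close>.\<close>

lemma dcl_eq: "dcl_qf L M (insert b0 (carrier A)) = carrier B"
proof -
  have "dcl_qf L B (insert b0 (carrier A)) = carrier B"
    using witness unfolding RCP_witness_def by blast
  moreover have "dcl_qf L B (insert b0 (carrier A)) = dcl_qf L M (insert b0 (carrier A))"
    using strong witness M_in_K le_BM unfolding strong_enough_def by blast
  ultimately show ?thesis
    by simp
qed

lemma b0_in_B: "b0 \<in> carrier B"
proof -
  obtain b :: "nat \<Rightarrow> 'u" where "freely_generated L V B (range b)" "b 0 = b0"
    using witness unfolding RCP_witness_def by blast
  then show ?thesis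
    using freely_generatedD(2) by blast
qed

text \<open>Fixing the generators \<open>a i\<close> means fixing \<open>A\<close>. The third clause
  of \<open>strong_enough\<close> then gives \<open>f b0\<close> over \<open>A\<close> the same
  definable closure as \<open>b0\<close>, namely \<open>B\<close>, and \<open>f b0\<close> belongs
  to it.\<close>

lemma orbit_in_B:
  assumes f: "automorphism L M f" "\<And>i. f (a i) = a i"
  shows "f b0 \<in> carrier B"
proof -
  have id: "hom L A M id"
    using hom_inclusion[OF sub_AM] .
  have "f x = x" if "x \<in> carrier A" for x
  proof -
    have x: "x \<in> closure_in L A (range a)"
      using that freely_generatedD(4)[OF free_A] by simp
    have "f x = id x"
      by (rule hom_eq_on_closure_in[OF hom_restrict[OF isoD(1)[OF f(1)] sub_AM] id
            freely_generatedD(2)[OF free_A] _ x]) (use f(2) in auto)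
    then show ?thesis
      by simp
  qed
  then have "dcl_qf L M (insert b0 (carrier A)) = dcl_qf L M (insert (f b0) (carrier A))"
    using strong witness monster le_BM f(1) unfolding strong_enough_def by blast
  moreover have "f b0 \<in> carrier M"
    using homD(4)[OF isoD(1)[OF f(1)]] b0_in_B substructureD(3)[OF sub_BN] substructureD(3)[OF sub_NM]
    by blast
  then have "f b0 \<in> dcl_qf L M (insert (f b0) (carrier A))"
    using dcl_qf_extensive[of "insert (f b0) (carrier A)" M L] substructureD(3)[OF sub_AM] by auto
  ultimately show ?thesis
    using dcl_eq by simp
qed

lemma generated_A: "X \<subseteq> range a \<Longrightarrow> closure_in L N X \<subseteq> carrier A"
proof -
  assume X: "X \<subseteq> range a"
  then have XA: "X \<subseteq> carrier A"
    using freely_generatedD(2)[OF free_A] by auto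
  show ?thesis
    using closure_in_substructure[OF sub_AN XA]
      closure_in_subset_carrier[OF substructureD(1)[OF sub_AN] XA] by simp
qed

text \<open>The initial segment extends to a basis of \<open>B\<close>, which is then exchanged for
  \<open>Y1\<close> in \<open>N\<close>. No such statement is made for the whole sequence
  \<open>a\<close>.\<close>

lemma basis_extending:
  obtains Y where "a ` {..n} \<subseteq> Y" "Y \<subseteq> carrier B" "freely_generated L V B Y"
    "freely_generated L V N (Y \<union> Z)"
proof -
  have sub: "a ` {..n} \<subseteq> carrier A"
    using freely_generatedD(2)[OF free_A] by auto
  have "freely_generated L V (generated L A (a ` {..n})) (a ` {..n})"
    by (rule freely_generated_subset[OF V free_A]) auto
  then have "freely_generated L V (generated L B (a ` {..n})) (a ` {..n})"
    using generated_substructure[OF sub_AB sub] by simp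
  then obtain Y where Y: "a ` {..n} \<subseteq> Y" "freely_generated L V B Y"
    using free_factor_basis[OF V factor] by blast
  then have "freely_generated L V N (Y \<union> Z)"
    using freely_generated_exchange[OF V free_N disj] B_eq by simp
  then show thesis
    using that Y freely_generatedD(2)[OF Y(2)] by blast
qed

lemma Z_not_in_B: "z \<in> Z \<Longrightarrow> z \<notin> carrier B"
proof -
  assume z: "z \<in> Z"
  have "infinite (Z - {z})"
    using infinite_remove[OF uncountable_infinite[OF uncountable_Z]] .
  then obtain z' where "z' \<in> Z" "z' \<noteq> z"
    using infinite_imp_nonempty by blast
  then show ?thesis
    using basis_element_not_generated[OF V free_N, of Y1 z z'] z disj by (auto simp: B_eq)
qed

lemma automorphism_extends:
  assumes "le N0 M" "carrier N0 \<subseteq> carrier N" "automorphism L N0 k"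
  shows "\<exists>g. automorphism L M g \<and> (\<forall>x \<in> carrier N0. g x = k x)"
proof -
  have "|carrier N0| <o \<kappa>"
    using card_of_mono1[OF assms(2)] card_N ordLeq_ordLess_trans by blast
  moreover have "homogeneous_model L le \<kappa> M"
    using monster by (simp add: monster_def)
  ultimately show ?thesis
    using assms(1,3) unfolding homogeneous_model_def by blast
qed

text \<open>The exchange argument is run in a basis of \<open>N\<close> that contains both the
  initial segment of \<open>a\<close> and \<open>Z\<close>.\<close>

lemma generated_if_countable_orbit_over_initial:
  assumes b: "b \<in> carrier B" and C: "C \<subseteq> Z" "countable C" and T: "countable T"
    and orbit: "\<And>g. automorphism L M g \<Longrightarrow> (\<And>x. x \<in> a ` {..n} \<union> C \<Longrightarrow> g x = x) \<Longrightarrow> g b \<in> T"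
  shows "b \<in> carrier A"
proof -
  obtain Y where Y: "a ` {..n} \<subseteq> Y" "Y \<subseteq> carrier B" "freely_generated L V B Y"
    "freely_generated L V N (Y \<union> Z)"
    by (rule basis_extending)
  have YZ: "Y \<inter> Z = {}"
    using Y(2) Z_not_in_B by auto
  have "b \<in> closure_in L N (a ` {..n})"
  proof (rule generated_if_countable_orbit[OF V Y(4) sub_NM _ _ _ _ _ uncountable_Z _ C T orbit])
    show "\<exists>g. automorphism L M g \<and> (\<forall>x\<in>carrier N. g x = k x)" if "automorphism L N k" for k
      using automorphism_extends[OF le_NM order_refl that] .
    have "Y \<union> Z - Z = Y"
      using YZ by auto
    then show "b \<in> closure_in L N (Y \<union> Z - Z)"
      using b freely_generatedD(4)[OF Y(3)] closure_in_substructure[OF sub_BN Y(2)] by simp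
  qed (use Y(1) YZ in auto)
  then show ?thesis
    using generated_A[of "a ` {..n}"] by auto
qed

text \<open>Otherwise every element of \<open>B\<close> is definable over \<open>A\<close>, hence
  fixed by all automorphisms fixing some \<open>a 0, ..., a n\<close>. Its orbit is then a
  singleton, which forces it into \<open>A\<close>. So \<open>A = B\<close>, a free factor of the
  free product \<open>N\<close> of \<open>B\<close> and the algebra on \<open>Z\<close>, against
  RCP.\<close>

lemma b0_not_in_A: "b0 \<notin> carrier A"
proof
  assume "b0 \<in> carrier A"
  then have dcl: "dcl_qf L M (carrier A) = carrier B"
    using dcl_eq by (simp add: insert_absorb)
  have "b \<in> carrier A" if b: "b \<in> carrier B" for b
  proof -
    obtain C where C: "finite C" "C \<subseteq> carrier A"
      and fixed: "\<And>g. automorphism L M g \<Longrightarrow> (\<And>c. c \<in> C \<Longrightarrow> g c = c) \<Longrightarrow> g b = b"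
      using dcl_qf_fixed[of b L M "carrier A"] b dcl substructureD(3)[OF sub_AM] by blast
    have range: "range a = (\<Union>n. a ` {..n})"
      by auto
    have mono: "a ` {..m} \<subseteq> a ` {..n}" if "m \<le> n" for m n
      using that by auto
    have "closure_in L A (range a) = (\<Union>n. closure_in L A (a ` {..n}))"
      unfolding range by (rule closure_in_chain[OF mono])
    then have "C \<subseteq> (\<Union>n. closure_in L A (a ` {..n}))"
      using C(2) freely_generatedD(4)[OF free_A] by simp
    then obtain n where n: "C \<subseteq> closure_in L A (a ` {..n})"
      using finite_chain_bound[OF C(1), of "\<lambda>n. closure_in L A (a ` {..n})"] closure_in_mono[OF mono]
      by blast
    show ?thesis
    proof (rule generated_if_countable_orbit_over_initial[OF b, of "{}" "{b}" n])
      fix g assume g: "automorphism L M g" "\<And>x. x \<in> a ` {..n} \<union> {} \<Longrightarrow> g x = x"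
      have "g c = id c" if "c \<in> C" for c
      proof (rule hom_eq_on_closure_in[OF hom_restrict[OF isoD(1)[OF g(1)] sub_AM] hom_inclusion[OF sub_AM]])
        show "c \<in> closure_in L A (a ` {..n})"
          using n that by auto
        show "a ` {..n} \<subseteq> carrier A"
          using freely_generatedD(2)[OF free_A] by auto
      qed (use g(2) in auto)
      then show "g b \<in> {b}"
        using fixed[OF g(1)] by simp
    qed auto
  qed
  then have "carrier A = carrier B"
    using substructureD(3)[OF sub_AB] by auto
  then have AB: "A = B"
    using substructure_eqI[OF sub_AN sub_BN] by simp
  have "Z \<noteq> {}"
    using uncountable_Z by auto
  moreover have "Y1 \<noteq> {}"
    using inf_Y1 by auto
  ultimately have "free_product L V B (generated L N Z) N" "freely_generated L V (generated L N Z) Z"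
    "free_factor L V B N"
    unfolding B_eq using free_product_of_basis_split[OF V free_N disj]
      freely_generated_subset[OF V free_N, of Z] free_factor_of_subbasis[OF V free_N, of Y1] disj
    by auto
  then show False
    using witness AB unfolding RCP_witness_def free_algs_def by blast
qed

text \<open>This is the model over which types are counted. Unlike in \<open>N\<close>, the whole
  sequence \<open>a\<close> belongs to a basis here and can be permuted with elements of
  \<open>Z\<close>.\<close>

definition "N0 = generated L N (range a \<union> Z)"

lemma range_a_subset: "range a \<subseteq> carrier A" "range a \<subseteq> carrier B" "range a \<subseteq> carrier N"
proof -
  show "range a \<subseteq> carrier A"
    using freely_generatedD(2)[OF free_A] .
  then show "range a \<subseteq> carrier B" "range a \<subseteq> carrier N"
    using substructureD(3)[OF sub_AB] substructureD(3)[OF sub_AN] by auto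
qed

lemma sub_N0N: "substructure L N0 N"
  unfolding N0_def using range_a_subset basis_N by (intro substructure_generated[OF sN]) auto

lemma a_not_in_Z: "a i \<notin> Z"
  using range_a_subset Z_not_in_B by blast

lemma union_initial: "range a \<union> Z = (\<Union>n. a ` {..n} \<union> Z)"
  by auto

lemma mono_initial: "m \<le> n \<Longrightarrow> a ` {..m} \<union> Z \<subseteq> a ` {..n} \<union> Z"
  by auto

text \<open>For each \<open>n\<close> the elements \<open>a 0, ..., a n\<close> and \<open>Z\<close>
  are part of some basis of \<open>N\<close>. The bases vary with \<open>n\<close>, but freeness of
  the stages passes to their union.\<close>

lemma free_N0: "freely_generated L V N0 (range a \<union> Z)"
  unfolding N0_def union_initial
proof (rule freely_generated_chain[OF V freely_generatedD(1)[OF free_N] mono_initial])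
  fix n
  show "a ` {..n} \<union> Z \<subseteq> carrier N"
    using range_a_subset basis_N by auto
  obtain Y where Y: "a ` {..n} \<subseteq> Y" "freely_generated L V N (Y \<union> Z)"
    by (rule basis_extending)
  then show "freely_generated L V (generated L N (a ` {..n} \<union> Z)) (a ` {..n} \<union> Z)"
    by (intro freely_generated_subset[OF V Y(2)]) auto
qed

text \<open>Each stage is generated by part of a basis of \<open>N\<close>, infinite because of
  \<open>Z\<close>, and so is strong in \<open>N\<close>; the chain axiom handles the union.\<close>

lemma le_N0M: "le N0 M"
proof -
  have "le N0 N"
  proof (rule AEC_omega_chain[OF AEC natLeq_less, where N = "\<lambda>n. generated L N (a ` {..n} \<union> Z)"])
    fix n
    obtain Y where Y: "a ` {..n} \<subseteq> Y" "freely_generated L V N (Y \<union> Z)"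
      by (rule basis_extending)
    have "infinite (a ` {..n} \<union> Z)"
      using uncountable_infinite[OF uncountable_Z] by auto
    then show "le (generated L N (a ` {..n} \<union> Z)) N"
      using Y(1) by (intro strong_of_subbasis[OF V cov Y(2)]) auto
  next
    fix m n :: nat assume "m \<le> n"
    then show "carrier (generated L N (a ` {..m} \<union> Z)) \<subseteq> carrier (generated L N (a ` {..n} \<union> Z))"
      using closure_in_mono[OF mono_initial] by simp
  next
    show "carrier N0 = (\<Union>n. carrier (generated L N (a ` {..n} \<union> Z)))"
      unfolding N0_def union_initial carrier_generated by (rule closure_in_chain[OF mono_initial])
  qed (rule sub_N0N)
  then show ?thesis
    using AEC_D(8)[OF AEC _ le_NM] by blast
qed

lemma a_in_N0: "a i \<in> carrier N0" and Z_in_N0: "Z \<subseteq> carrier N0"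
  using freely_generatedD(2)[OF free_N0] by auto

lemma N0_subset_M: "carrier N0 \<subseteq> carrier M"
  using substructureD(3)[OF sub_N0N] substructureD(3)[OF sub_NM] by auto

text \<open>
  The sequences \<open>p\<close> play the role of the branches of a tree: moving \<open>a\<close> to two branches with
  only finitely many common nodes separates the corresponding images of \<open>b0\<close>.
\<close>

lemma branch_automorphism:
  assumes p: "inj p" "range p \<subseteq> Z"
  shows "\<exists>F. automorphism L M F \<and> (\<forall>i. F (a i) = p i \<and> F (p i) = a i) \<and> (\<forall>z \<in> Z - range p. F z = z)"
proof -
  \<comment> \<open>This sends \<open>a i\<close> to \<open>p i\<close>. Swapping along it permutes
    the basis of \<open>N0\<close> and leaves the remaining elements of \<open>Z\<close> in
    place.\<close>
  let ?f = "\<lambda>x. p (inv a x)"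
  have inv_a: "inv a (a i) = i" for i
    using inj_a by simp
  have f: "inj_on ?f (range a)" "?f ` range a = range p"
    by (auto simp: inj_on_def inv_a inj_eq[OF p(1)] image_image)
  have "a i \<noteq> p j" for i j
    using p(2) a_not_in_Z[of i] by auto
  then have f: "inj_on ?f (range a)" "?f ` range a = range p" "range a \<inter> ?f ` range a = {}"
    using f by (auto simp: image_image inv_a)
  have "bij_betw (swap_along ?f (range a)) (range a \<union> Z) (range a \<union> Z)"
    using p(2) f(2) by (intro swap_along_bij[OF f(1,3)]) auto
  from freely_generated_bij[OF V free_N0 free_N0 this] obtain k
    where k: "automorphism L N0 k" "\<And>x. x \<in> range a \<union> Z \<Longrightarrow> k x = swap_along ?f (range a) x"
    by blast
  obtain F where F: "automorphism L M F" "\<And>x. x \<in> carrier N0 \<Longrightarrow> F x = k x"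
    using automorphism_extends[OF le_N0M substructureD(3)[OF sub_N0N] k(1)] by blast
  have Fx: "F x = swap_along ?f (range a) x" if "x \<in> range a \<union> Z" for x
    using that F(2) k(2) a_in_N0 Z_in_N0 by auto
  have "F (a i) = p i" for i
    using Fx[of "a i"] swap_along_simps(1)[OF f(1,3), of "a i"] inj_a by simp
  moreover have "F (p i) = a i" for i
    using Fx[of "p i"] swap_along_simps(2)[OF f(1,3), of "a i"] inj_a p(2) by auto
  moreover have "F z = z" if "z \<in> Z - range p" for z
    using Fx[of z] swap_along_simps(3)[OF f(1,3), of z] that a_not_in_Z f(2) by auto
  ultimately show ?thesis
    using F(1) by blast
qed

text \<open>If \<open>h (F b0) = F' b0\<close>, then \<open>?H\<close>, the inverse of
  \<open>?hF\<close> after \<open>F'\<close>, fixes \<open>b0\<close>. It fixes \<open>a i\<close>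
  for \<open>i \<le> m\<close> and sends the other \<open>a i\<close> to \<open>p' i\<close>. The
  orbit of \<open>b0\<close> over \<open>a 0, ..., a m\<close> and the range of \<open>p'\<close>
  then lies in the countable image of \<open>B\<close> under \<open>?H\<close>, which would put
  \<open>b0\<close> into \<open>A\<close>.\<close>

lemma branches_separated:
  assumes F: "automorphism L M F" "\<And>i. F (a i) = p i" "\<And>i. F (p i) = a i"
      "\<And>z. z \<in> Z - range p \<Longrightarrow> F z = z"
    and F': "automorphism L M F'" "\<And>i. F' (a i) = p' i"
    and p': "range p' \<subseteq> Z"
    and common: "\<And>i. i \<le> m \<Longrightarrow> p i = p' i" "\<And>i. i > m \<Longrightarrow> p' i \<notin> range p"
    and h: "automorphism L M h" "\<And>x. x \<in> carrier N0 \<Longrightarrow> h x = x"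
  shows "h (F b0) \<noteq> F' b0"
proof
  assume hb: "h (F b0) = F' b0"
  let ?hF = "h \<circ> F"
  let ?H = "inv_into (carrier M) ?hF \<circ> F'"
  have hF: "automorphism L M ?hF"
    using F(1) h(1) by (rule iso_comp)
  have H: "automorphism L M ?H"
    using F'(1) iso_inv_into[OF hF] by (rule iso_comp)
  have b0M: "b0 \<in> carrier M"
    using b0_in_B substructureD(3)[OF sub_BN] substructureD(3)[OF sub_NM] by auto
  have inv: "inv_into (carrier M) ?hF y = x" if "x \<in> carrier M" "h (F x) = y" for x y
    using inv_into_f_eq[OF isoD(3)[OF hF] that(1)] that(2) by simp
  have Hb0: "?H b0 = b0"
    using inv[OF b0M] hb by simp
  have aM: "a i \<in> carrier M" for i
    using a_in_N0 N0_subset_M by auto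
  have p'Z: "p' i \<in> Z" for i
    using p' by auto
  have p'N0: "p' i \<in> carrier N0" for i
    using p'Z Z_in_N0 by auto
  have Ha: "?H (a i) \<in> a ` {..m} \<union> range p'" for i
  proof (cases "i \<le> m")
    case True
    have "inv_into (carrier M) ?hF (p' i) = a i"
      using common(1)[OF True] F(2) h(2)[OF p'N0] by (intro inv aM) simp
    then show ?thesis
      using True F'(2) by simp
  next
    case False
    then have "p' i \<notin> range p"
      using common(2)[of i] by simp
    then have "F (p' i) = p' i"
      using p'Z by (intro F(4)) auto
    moreover have "p' i \<in> carrier M"
      using p'N0 N0_subset_M by auto
    ultimately have "inv_into (carrier M) ?hF (p' i) = p' i"
      using h(2)[OF p'N0] by (intro inv) auto
    then show ?thesis
      using F'(2) by simp
  qed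
  have "b0 \<in> carrier A"
  proof (rule generated_if_countable_orbit_over_initial[OF b0_in_B p', of "?H ` carrier B" m])
    show "countable (?H ` carrier B)"
      using witness by (intro countable_image) (simp add: RCP_witness_def)
    fix g assume g: "automorphism L M g" "\<And>x. x \<in> a ` {..m} \<union> range p' \<Longrightarrow> g x = x"
    \<comment> \<open>Since \<open>g\<close> fixes every \<open>?H (a i)\<close>, this conjugate
      fixes every \<open>a i\<close>, and \<open>orbit_in_B\<close> applies to it.\<close>
    let ?c = "inv_into (carrier M) ?H \<circ> (g \<circ> ?H)"
    have "automorphism L M ?c"
      using iso_comp[OF iso_comp[OF H g(1)] iso_inv_into[OF H]] .
    moreover have "?c (a i) = a i" for i
      using automorphism_conjugate_fixed[OF H g(1) _ aM] g(2)[OF Ha] by blast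
    ultimately have "?c b0 \<in> carrier B"
      by (rule orbit_in_B)
    then have "inv_into (carrier M) ?H (g b0) \<in> carrier B"
      using Hb0 by simp
    moreover have "g b0 \<in> ?H ` carrier M"
      using homD(4)[OF isoD(1)[OF g(1)] b0M] isoD(4)[OF H] by simp
    then have "?H (inv_into (carrier M) ?H (g b0)) = g b0"
      by (rule f_inv_into_f)
    ultimately show "g b0 \<in> ?H ` carrier B"
      by (metis image_eqI)
  qed auto
  then show False
    using b0_not_in_A by simp
qed

lemma many_types:
  assumes \<beta>: "inj_on \<beta> (lists S)" "\<beta> ` lists S \<subseteq> Z"
  shows "\<exists>c :: (nat \<Rightarrow> 's) \<Rightarrow> 'u. \<forall>\<eta> \<nu>. range \<eta> \<subseteq> S \<longrightarrow> range \<nu> \<subseteq> S \<longrightarrow> \<eta> \<noteq> \<nu> \<longrightarrow>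
    c \<eta> \<in> carrier M \<and> (\<forall>h. automorphism L M h \<and> (\<forall>x \<in> carrier N0. h x = x) \<longrightarrow> h (c \<eta>) \<noteq> c \<nu>)"
proof -
  \<comment> \<open>The node of length \<open>i\<close> on the branch \<open>\<eta>\<close>. If
    \<open>m\<close> is the first place where two branches differ, their nodes of length up to and
    including \<open>m\<close> coincide and all longer ones are distinct.\<close>
  define p where "p \<eta> i = \<beta> (map \<eta> [0..<i])" for \<eta> :: "nat \<Rightarrow> 's" and i
  have mem: "map \<eta> [0..<i] \<in> lists S" if "range \<eta> \<subseteq> S" for \<eta> and i :: nat
    using that by (auto simp: image_subset_iff)
  have p_eq: "p \<eta> i = p \<nu> j \<longleftrightarrow> map \<eta> [0..<i] = map \<nu> [0..<j]" if "range \<eta> \<subseteq> S" "range \<nu> \<subseteq> S" for \<eta> \<nu> i j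
    unfolding p_def using inj_on_eq_iff[OF \<beta>(1) mem mem] that by blast
  have pZ: "range (p \<eta>) \<subseteq> Z" if "range \<eta> \<subseteq> S" for \<eta>
    using \<beta>(2) mem[OF that] unfolding p_def by auto
  have inj_p: "inj (p \<eta>)" if "range \<eta> \<subseteq> S" for \<eta>
  proof (rule injI)
    fix i j assume "p \<eta> i = p \<eta> j"
    then have "length (map \<eta> [0..<i]) = length (map \<eta> [0..<j])"
      using p_eq[OF that that] by simp
    then show "i = j"
      by simp
  qed
  have "\<exists>F. range \<eta> \<subseteq> S \<longrightarrow> automorphism L M F \<and> (\<forall>i. F (a i) = p \<eta> i \<and> F (p \<eta> i) = a i) \<and>
      (\<forall>z \<in> Z - range (p \<eta>). F z = z)" for \<eta>
    using branch_automorphism[OF inj_p pZ] by blast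
  then obtain F where F: "\<And>\<eta>. range \<eta> \<subseteq> S \<Longrightarrow> automorphism L M (F \<eta>) \<and>
      (\<forall>i. F \<eta> (a i) = p \<eta> i \<and> F \<eta> (p \<eta> i) = a i) \<and> (\<forall>z \<in> Z - range (p \<eta>). F \<eta> z = z)"
    by metis
  show ?thesis
  proof (intro exI[of _ "\<lambda>\<eta>. F \<eta> b0"] allI impI conjI; (elim conjE)?)
    fix \<eta> \<nu> :: "nat \<Rightarrow> 's" assume S: "range \<eta> \<subseteq> S" "range \<nu> \<subseteq> S" and "\<eta> \<noteq> \<nu>"
    have "b0 \<in> carrier M"
      using b0_in_B substructureD(3)[OF sub_BN] substructureD(3)[OF sub_NM] by auto
    then show "F \<eta> b0 \<in> carrier M"
      using F[OF S(1)] homD(4)[OF isoD(1), of L M M "F \<eta>" b0] by simp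
    obtain m where m: "\<eta> m \<noteq> \<nu> m" "\<And>i. i < m \<Longrightarrow> \<eta> i = \<nu> i"
      using least_difference[OF \<open>\<eta> \<noteq> \<nu>\<close>] by blast
    fix h assume h: "automorphism L M h" "\<forall>x\<in>carrier N0. h x = x"
    show "h (F \<eta> b0) \<noteq> F \<nu> b0"
    proof (rule branches_separated[where F = "F \<eta>" and F' = "F \<nu>" and p = "p \<eta>" and p' = "p \<nu>" and m = m])
      show "p \<eta> i = p \<nu> i" if "i \<le> m" for i
        using m(2) that by (simp add: p_eq[OF S])
      show "p \<nu> i \<notin> range (p \<eta>)" if "i > m" for i
      proof
        assume "p \<nu> i \<in> range (p \<eta>)"
        \<comment> \<open>Equal nodes have equal length, so \<open>j = i > m\<close>, and comparing
          the entries at \<open>m\<close> contradicts the choice of \<open>m\<close>.\<close>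
        then obtain j where "map \<nu> [0..<i] = map \<eta> [0..<j]"
          using p_eq[OF S(2,1)] by auto
        then have "map \<nu> [0..<i] ! m = map \<eta> [0..<j] ! m" and "length (map \<nu> [0..<i]) = length (map \<eta> [0..<j])"
          by simp_all
        then show False
          using m(1) that by simp
      qed
    qed (use F S h pZ in auto)
  qed
qed

end

section \<open>Isomorphic copies of monster models\<close>

lemma iso_card_of: "iso L A B h \<Longrightarrow> |carrier A| =o |carrier B|"
  using isoD(2) card_of_ordIso by blast

lemma substructure_if_hom_id: "hom L A B id \<Longrightarrow> substructure L A B"
  using homD[of L A B id] by (intro substructureI) auto

text \<open>The copy of \<open>A\<close> along the inverse of \<open>k\<close> is strong in
  \<open>M\<close> by closure of \<open>le\<close> under isomorphism. The isomorphism back is given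
  by \<open>k\<close> itself, so that later transports can use one map.\<close>

lemma strong_pullback:
  assumes AEC: "AEC L K le" and k: "iso L M M' k" and A: "le A M'"
  obtains A' where "le A' M" "iso L A' A k"
proof -
  let ?k = "inv_into (carrier M) k"
  have k': "iso L M' M ?k"
    using iso_inv_into[OF k] .
  have sub: "substructure L A M'"
    using AEC_D(6)[OF AEC A] .
  have inj: "inj_on ?k (carrier A)"
    using isoD(3)[OF k'] substructureD(3)[OF sub] by (rule inj_on_subset)
  from iso_copy_exists[OF substructureD(1)[OF sub] inj]
  obtain A' where A': "carrier A' = ?k ` carrier A" "iso L A A' ?k"
    by blast
  have "le A' M"
    using AEC_D(5)[OF AEC A k' A'(2)] .
  moreover have "iso L A' A k"
  proof (rule iso_cong[OF iso_inv_into[OF A'(2)]])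
    fix x assume "x \<in> carrier A'"
    then obtain y where y: "y \<in> carrier A" "x = ?k y"
      using A'(1) by auto
    then have "y \<in> k ` carrier M"
      using substructureD(3)[OF sub] isoD(4)[OF k] by auto
    then show "inv_into (carrier A) ?k x = k x"
      using y inv_into_f_f[OF inj y(1)] by (simp add: f_inv_into_f)
  qed
  ultimately show thesis
    using that by blast
qed

lemma automorphism_conjugate:
  assumes k: "iso L M M' k" and g: "automorphism L M g"
  obtains g' where "automorphism L M' g'" "\<And>x. x \<in> carrier M \<Longrightarrow> g' (k x) = k (g x)"
proof -
  let ?g = "k \<circ> (g \<circ> inv_into (carrier M) k)"
  have "automorphism L M' ?g"
    using iso_comp[OF iso_comp[OF iso_inv_into[OF k] g] k] .
  moreover have "?g (k x) = k (g x)" if "x \<in> carrier M" for x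
    using inv_into_f_f[OF isoD(3)[OF k] that] by simp
  ultimately show thesis
    by (rule that)
qed

text \<open>Strong embeddings into \<open>M\<close> are composed with \<open>k\<close>. For
  homogeneity the two submodels are pulled back to \<open>M\<close>, the isomorphism is extended
  there, and the extension is conjugated by \<open>k\<close>.\<close>

lemma monster_iso:
  assumes AEC: "AEC L K le" and M: "monster L K le \<kappa> M" and k: "iso L M M' k"
  shows "monster L K le \<kappa> M'"
proof -
  have MK: "M \<in> K" and univ: "universal_model L K le \<kappa> M" and homog: "homogeneous_model L le \<kappa> M"
    using M by (simp_all add: monster_def)
  have "universal_model L K le \<kappa> M'"
    unfolding universal_model_def
  proof (intro ballI impI)
    fix C assume "C \<in> K" "|carrier C| \<le>o \<kappa>"
    then obtain f where f: "embedding L C M f" "le (induced L M (f ` carrier C)) M"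
      using univ unfolding universal_model_def strong_embedding_def by blast
    have kf: "embedding L C M' (k \<circ> f)"
      using f(1) hom_comp[OF _ isoD(1)[OF k]] homD(3)[of L C M f] isoD(3)[OF k]
      unfolding embedding_def by (auto intro!: comp_inj_on intro: inj_on_subset)
    have inj: "inj_on f (carrier C)"
      using f(1) by (simp add: embedding_def)
    \<comment> \<open>Closure of \<open>le\<close> under isomorphism asks one map to serve both
      submodel and model, so the composite isomorphism is recognised as \<open>k\<close>.\<close>
    have "iso L (induced L M (f ` carrier C)) (induced L M' ((k \<circ> f) ` carrier C)) k"
      using iso_comp[OF iso_inv_into[OF embedding_iso_image(2)[OF f(1)]] embedding_iso_image(2)[OF kf]]
    proof (rule iso_cong)
      fix x assume "x \<in> carrier (induced L M (f ` carrier C))"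
      then show "((k \<circ> f) \<circ> inv_into (carrier C) f) x = k x"
        using inj by (auto simp: f_inv_into_f)
    qed
    then show "\<exists>h. strong_embedding L le C M' h"
      using AEC_D(5)[OF AEC f(2) k] kf unfolding strong_embedding_def by blast
  qed
  moreover have "homogeneous_model L le \<kappa> M'"
    unfolding homogeneous_model_def
  proof (intro allI impI; elim conjE)
    fix A0 A1 h
    assume A: "le A0 M'" "le A1 M'" "|carrier A0| <o \<kappa>" "|carrier A1| <o \<kappa>" and h: "iso L A0 A1 h"
    obtain B0 where B0: "le B0 M" "iso L B0 A0 k"
      using strong_pullback[OF AEC k A(1)] .
    obtain B1 where B1: "le B1 M" "iso L B1 A1 k"
      using strong_pullback[OF AEC k A(2)] .
    let ?h = "inv_into (carrier B1) k \<circ> (h \<circ> k)"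
    have h': "iso L B0 B1 ?h"
      using iso_comp[OF iso_comp[OF B0(2) h] iso_inv_into[OF B1(2)]] .
    moreover have "|carrier B0| <o \<kappa>" "|carrier B1| <o \<kappa>"
      using iso_card_of[OF B0(2)] iso_card_of[OF B1(2)] A(3,4) ordIso_ordLess_trans by blast+
    ultimately obtain g where g: "automorphism L M g" "\<And>x. x \<in> carrier B0 \<Longrightarrow> g x = ?h x"
      using homog B0(1) B1(1) unfolding homogeneous_model_def by blast
    obtain g' where g': "automorphism L M' g'" "\<And>x. x \<in> carrier M \<Longrightarrow> g' (k x) = k (g x)"
      using automorphism_conjugate[OF k g(1)] by blast
    have "g' x = h x" if "x \<in> carrier A0" for x
    proof -
      obtain y where y: "y \<in> carrier B0" "x = k y"
        using \<open>x \<in> carrier A0\<close> isoD(4)[OF B0(2)] by auto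
      then have "h (k y) \<in> k ` carrier B1"
        using that homD(4)[OF isoD(1)[OF h]] isoD(4)[OF B1(2)] by auto
      moreover have "y \<in> carrier M"
        using y(1) substructureD(3)[OF AEC_D(6)[OF AEC B0(1)]] by auto
      ultimately show ?thesis
        using g'(2) g(2)[OF y(1)] y(2) by (simp add: f_inv_into_f)
    qed
    then show "\<exists>g. automorphism L M' g \<and> (\<forall>x \<in> carrier A0. g x = h x)"
      using g'(1) by blast
  qed
  moreover have "M' \<in> K"
    using AEC_D(4)[OF AEC MK k] .
  ultimately show ?thesis
    using M by (simp add: monster_def)
qed

section \<open>Cardinals of countable cofinality\<close>

text \<open>Diagonalisation: given an enumeration \<open>f\<close> of the sequences by
  \<open>S\<close>, the \<open>n\<close>-th entry of \<open>g\<close> avoids the fewer than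
  \<open>|S|\<close> values \<open>f s n\<close> with \<open>s\<close> in \<open>T n\<close>. Every
  \<open>s\<close> lies in some \<open>T n\<close>, so \<open>g\<close> is not enumerated.\<close>

lemma koenig_sequences:
  assumes S: "S = (\<Union>n. T n)" and T: "\<And>n :: nat. |T n| <o |S|"
  shows "\<not> |{\<eta> :: nat \<Rightarrow> 'a. range \<eta> \<subseteq> S}| \<le>o |S|"
proof
  assume le: "|{\<eta> :: nat \<Rightarrow> 'a. range \<eta> \<subseteq> S}| \<le>o |S|"
  have diag: "\<exists>x \<in> S. x \<notin> (\<lambda>s. f s n) ` T n" for f :: "'a \<Rightarrow> nat \<Rightarrow> 'a" and n
  proof (rule ccontr)
    assume "\<not> ?thesis"
    then have "|S| \<le>o |(\<lambda>s. f s n) ` T n|"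
      by (intro card_of_mono1) auto
    then show False
      using T[of n] card_of_image[of "\<lambda>s. f s n" "T n"] not_ordLess_ordLeq ordLeq_transitive by blast
  qed
  then obtain x where "x \<in> S"
    by blast
  then have "{\<eta> :: nat \<Rightarrow> 'a. range \<eta> \<subseteq> S} \<noteq> {}"
    by (auto intro!: exI[of _ "\<lambda>_. x"])
  then obtain f where f: "f ` S = {\<eta> :: nat \<Rightarrow> 'a. range \<eta> \<subseteq> S}"
    using le card_of_ordLeq2[of "{\<eta> :: nat \<Rightarrow> 'a. range \<eta> \<subseteq> S}" S] by auto
  obtain g where g: "\<And>n. g n \<in> S" "\<And>n. g n \<notin> (\<lambda>s. f s n) ` T n"
    using diag[of f] by metis
  then have "g \<in> f ` S"
    using f by auto
  then obtain n s where "s \<in> T n" "g = f s"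
    using S by auto
  then show False
    using g(2)[of n] by blast
qed

text \<open>Starting from the field of \<open>\<mu>\<close> and a countably infinite set, each step
  passes to a set larger than the last, coded from its power set. The union strictly exceeds every
  stage because the next stage already does, and regularity keeps it small.\<close>

lemma inaccessible_tower:
  fixes \<mu> :: "'u rel"
  assumes inacc: "inaccessible |UNIV :: 'u set|" and \<mu>: "cardinal \<mu>"
  obtains S :: "'u set" and T :: "nat \<Rightarrow> 'u set"
    where "S = (\<Union>n. T n)" "\<And>n. |T n| <o |S|" "small S" "uncountable S" "\<mu> \<le>o |S|"
proof -
  have nat: "natLeq <o |UNIV :: 'u set|" and reg: "regularCard |UNIV :: 'u set|"
    and Pow: "\<And>X :: 'u set. small X \<Longrightarrow> |Pow X| <o |UNIV :: 'u set|"
    using inacc by (auto simp: inaccessible_def small_def)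
  have natU: "|UNIV :: nat set| <o |UNIV :: 'u set|"
    using card_of_nat nat by (rule ordIso_ordLess_trans)
  then have infU: "infinite (UNIV :: 'u set)"
    using infinite_iff_card_of_nat ordLess_imp_ordLeq by blast
  then obtain \<iota> :: "nat \<Rightarrow> 'u" where \<iota>: "inj \<iota>"
    using infinite_countable_subset by blast
  \<comment> \<open>The implication under the quantifier lets \<open>up\<close> be chosen as a total
    function.\<close>
  have "\<exists>Y :: 'u set. small X \<longrightarrow> small Y \<and> |X| <o |Y|" for X :: "'u set"
  proof (cases "small X")
    case True
    then obtain j :: "'u set \<Rightarrow> 'u" where "inj_on j (Pow X)"
      using ordLess_imp_ordLeq[OF Pow[OF True]] unfolding card_of_ordLeq[symmetric] by auto
    then have "|Pow X| =o |j ` Pow X|"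
      using card_of_ordIso inj_on_imp_bij_betw by blast
    then have "small (j ` Pow X)" "|X| <o |j ` Pow X|"
      using Pow[OF True] card_of_Pow[of X] ordIso_symmetric ordIso_ordLess_trans ordLess_ordIso_trans
      unfolding small_def by blast+
    then show ?thesis
      by (intro exI[of _ "j ` Pow X"]) simp
  qed auto
  then obtain up :: "'u set \<Rightarrow> 'u set" where up: "\<And>X :: 'u set. small X \<Longrightarrow> small (up X) \<and> |X| <o |up X|"
    by metis
  define T where "T = rec_nat (Field \<mu> \<union> range \<iota>) (\<lambda>_. up)"
  have T0: "T 0 = Field \<mu> \<union> range \<iota>" and TS: "T (Suc n) = up (T n)" for n
    by (simp_all add: T_def)
  define S where "S = (\<Union>n. T n)"
  have \<mu>_card: "Card_order \<mu>" and \<mu>U: "\<mu> <o |UNIV :: 'u set|"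
    using \<mu> by (auto simp: cardinal_def)
  have smallT: "small (T n)" for n
  proof (induction n)
    case 0
    have "|Field \<mu>| <o |UNIV :: 'u set|"
      using card_of_Field_ordIso[OF \<mu>_card] \<mu>U by (rule ordIso_ordLess_trans)
    moreover have "|range \<iota>| <o |UNIV :: 'u set|"
      using card_of_image natU by (rule ordLeq_ordLess_trans)
    ultimately show ?case
      unfolding small_def T0 using infU by (intro card_of_Un_ordLess_infinite)
  qed (use up TS in auto)
  have step: "|T n| <o |T (Suc n)|" for n
    using up[OF smallT] by (simp add: TS)
  have TleS: "|T n| \<le>o |S|" for n
    unfolding S_def by (intro card_of_mono1) auto
  have TltS: "|T n| <o |S|" for n
    using step TleS by (rule ordLess_ordLeq_trans)
  have "small S"
    unfolding small_def S_def
    using reg infU natU smallT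
    by (intro card_of_UNION_ordLess_infinite_Field_regularCard)
      (auto simp: small_def cinfinite_def card_of_Card_order Field_card_of card_of_card_order_on)
  moreover have "uncountable S"
  proof
    assume "countable S"
    moreover have "infinite (T 0)"
      using range_inj_infinite[OF \<iota>] by (simp add: T0)
    ultimately have "|S| \<le>o |T 0|"
      by (rule countable_ordLeq)
    then show False
      using TltS[of 0] not_ordLess_ordLeq by blast
  qed
  moreover have "\<mu> \<le>o |S|"
  proof -
    have "|Field \<mu>| \<le>o |T 0|"
      unfolding T0 by (intro card_of_mono1) auto
    then show ?thesis
      using TleS[of 0] card_of_Field_ordIso[OF \<mu>_card] ordIso_symmetric ordIso_ordLeq_trans ordLeq_transitive
      by blast
  qed
  ultimately show thesis
    using that S_def TltS by blast
qed

section \<open>Failure of stability\<close>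

text \<open>A free algebra on a basis with one part for \<open>b\<close> and one for the tree is
  renamed so that the subalgebra generated by the first part becomes \<open>B\<close>
  itself.\<close>

lemma free_extension_exists:
  fixes L :: "('f \<times> nat) set" and V :: "('f, 'u) alg set" and S :: "'u set"
  assumes infU: "infinite (UNIV :: 'u set)" and V: "variety L V" and L: "countable L"
    and B: "freely_generated L V B (range b)" and b: "inj (b :: nat \<Rightarrow> 'u)"
    and S: "infinite S" "small S"
  obtains N \<beta> where "freely_generated L V N (range b \<union> \<beta> ` lists S)" "inj_on \<beta> (lists S)"
    "range b \<inter> \<beta> ` lists S = {}" "B = generated L N (range b)" "|carrier N| \<le>o |S|"
proof -
  \<comment> \<open>The left summand indexes the basis of \<open>B\<close>, the right one the nodes
    of the tree.\<close>
  let ?I = "(UNIV :: nat set) <+> lists S"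
  have "|?I| \<le>o |S|"
    using S(1) card_of_lists_ordLeq[OF S(1) card_of_mono1[OF order_refl]] infinite_iff_card_of_nat[of S]
    by (intro card_of_Plus_ordLeq_infinite_Field[where r = "|S|"])
      (auto simp: Field_card_of card_of_card_order_on)
  then obtain F e where F: "freely_generated L V F (e ` ?I)" and e: "inj_on e ?I" and cF: "|carrier F| \<le>o |S|"
    using free_algebra_exists[OF V L B range_inj_infinite[OF b] S, of ?I] by blast
  define y where "y n = e (Inl n)" for n :: nat
  have y: "inj y"
    using e by (auto simp: y_def inj_on_def)
  have eI: "e ` ?I = range y \<union> (\<lambda>s. e (Inr s)) ` lists S"
    by (auto simp: y_def Plus_def image_Un image_image)
  have sF: "is_structure L F"
    using freely_generated_structure[OF V F] .
  have yF: "range y \<subseteq> carrier F"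
    using freely_generatedD(2)[OF F] eI by auto
  have G: "freely_generated L V (generated L F (range y)) (range y)"
    by (rule freely_generated_subset[OF V F]) (auto simp: eI)
  have "bij_betw (b \<circ> inv y) (range y) (range b)"
    using inj_imp_bij_betw_inv[OF y] b by (intro bij_betw_trans) (auto simp: bij_betw_def)
  from freely_generated_bij[OF V G B this] obtain h0
    where h0: "iso L (generated L F (range y)) B h0" "\<And>x. x \<in> range y \<Longrightarrow> h0 x = (b \<circ> inv y) x"
    by blast
  have subG: "substructure L (generated L F (range y)) F"
    using sF yF by (rule substructure_generated)
  obtain N h where h: "iso L F N h" "\<And>x. x \<in> carrier (generated L F (range y)) \<Longrightarrow> h x = h0 x"
    using iso_extension[OF infU sF substructureD(3)[OF subG] isoD(3)[OF h0(1)]] by blast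
  have hy: "h (y n) = b n" for n
    using h(2)[of "y n"] h0(2)[of "y n"] y closure_in.base[of "y n" "range y" L F] by simp
  define \<beta> where "\<beta> s = h (e (Inr s))" for s
  have eq: "h ` e ` ?I = range b \<union> \<beta> ` lists S"
    unfolding eI by (simp add: image_Un image_image hy \<beta>_def)
  have free: "freely_generated L V N (range b \<union> \<beta> ` lists S)"
    using freely_generated_iso[OF V F h(1)] unfolding eq .
  have inj_he: "inj_on (h \<circ> e) ?I"
    using e isoD(3)[OF h(1)] freely_generatedD(2)[OF F] by (auto intro!: comp_inj_on intro: inj_on_subset)
  have "inj_on \<beta> (lists S)"
    using inj_he by (auto simp: inj_on_def \<beta>_def)
  moreover have "b n \<noteq> \<beta> s" if "s \<in> lists S" for n s
    using inj_onD[OF inj_he, of "Inl n" "Inr s"] that hy by (auto simp: \<beta>_def y_def)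
  then have "range b \<inter> \<beta> ` lists S = {}"
    by auto
  \<comment> \<open>On the subalgebra generated by \<open>y\<close>, the renaming \<open>h\<close>
    agrees with the isomorphism \<open>h0\<close> onto \<open>B\<close>. The inclusion of
    \<open>B\<close> is thus \<open>h\<close> after the inverse of \<open>h0\<close>, a
    homomorphism.\<close>
  moreover have "B = generated L N (range b)"
  proof (rule substructure_eqI)
    let ?i = "inv_into (carrier (generated L F (range y))) h0"
    have "hom L B N (h \<circ> ?i)"
      using hom_comp[OF isoD(1)[OF iso_inv_into[OF h0(1)]] hom_restrict[OF isoD(1)[OF h(1)] subG]] .
    moreover have "(h \<circ> ?i) x = id x" if "x \<in> carrier B" for x
    proof -
      have x: "x \<in> h0 ` carrier (generated L F (range y))"
        using that isoD(4)[OF h0(1)] by simp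
      show ?thesis
        using h(2)[OF inv_into_into[OF x]] f_inv_into_f[OF x] by simp
    qed
    ultimately show sub: "substructure L B N"
      using substructure_if_hom_id hom_cong[of L B N "h \<circ> ?i" id] by blast
    have bB: "range b \<subseteq> carrier B"
      using freely_generatedD(2)[OF B] .
    show "substructure L (generated L N (range b)) N"
      using substructureD(3)[OF sub] bB by (intro substructure_generated[OF substructureD(2)[OF sub]]) auto
    show "carrier B = carrier (generated L N (range b))"
      using closure_in_substructure[OF sub bB] freely_generatedD(4)[OF B] by simp
  qed
  moreover have "|carrier N| \<le>o |S|"
    using iso_card_of[OF h(1)] cF ordIso_symmetric ordIso_ordLeq_trans by blast
  ultimately show thesis
    using that free by blast
qed

theorem theorem1p7:
  fixes L :: "('f \<times> nat) set"
    and V K :: "('f, 'u) alg set"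
    and le :: "('f, 'u) alg \<Rightarrow> ('f, 'u) alg \<Rightarrow> bool"
  assumes "inaccessible (card_of (UNIV :: 'u set))"
    and "countable L"
    and "variety L V"
    and "RCP L V"
    and "AEC_covering L V K le"
    and "strong_enough L V K le"
  shows "\<not> superstable L K le"
proof
  note inacc = assms(1) and L = assms(2) and V = assms(3) and cov = assms(5) and strong = assms(6)
  assume "superstable L K le"
  then obtain \<mu> :: "'u rel" where \<mu>: "cardinal \<mu>"
    and stable: "\<And>lam. cardinal lam \<Longrightarrow> \<mu> \<le>o lam \<Longrightarrow> stable_in L K le lam"
    unfolding superstable_def by blast
  have AEC: "AEC L K le" and infK: "free_algs_inf L V \<subseteq> K"
    using cov by (simp_all add: AEC_covering_def)
  have nat: "natLeq <o |UNIV :: 'u set|"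
    using inacc by (simp add: inaccessible_def)
  \<comment> \<open>Stability will be refuted at \<open>|S|\<close>, a cardinal of countable
    cofinality beyond the given bound.\<close>
  obtain S :: "'u set" and T where S: "S = (\<Union>n. T n)" "\<And>n :: nat. |T n| <o |S|" "small S" "uncountable S" "\<mu> \<le>o |S|"
    using inaccessible_tower[OF inacc \<mu>] by blast
  have infS: "infinite S"
    using S(4) by (rule uncountable_infinite)
  then have infU: "infinite (UNIV :: 'u set)"
    using finite_subset[OF subset_UNIV] by blast
  have "cardinal |S|"
    using S(3) by (simp add: cardinal_def small_def card_of_Card_order)
  then obtain \<kappa> M where \<kappa>: "|S| <o \<kappa>" and M: "monster L K le \<kappa> M"
    and types: "\<And>B. le B M \<Longrightarrow> |carrier B| =o |S| \<Longrightarrow> |galois_types L M (carrier B)| \<le>o |S|"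
    using stable S(5) unfolding stable_in_def by blast
  obtain A B b0 where witness: "RCP_witness L V A B b0"
    using assms(4) unfolding RCP_def by blast
  then obtain a b :: "nat \<Rightarrow> 'u" where a: "inj a" "freely_generated L V A (range a)"
      "\<And>i. free_factor L V (generated L B (a ` {..i})) B"
    and b: "inj b" "freely_generated L V B (range b)"
    unfolding RCP_witness_def by blast
  obtain N \<beta> where N: "freely_generated L V N (range b \<union> \<beta> ` lists S)" "inj_on \<beta> (lists S)"
    "range b \<inter> \<beta> ` lists S = {}" "B = generated L N (range b)" "|carrier N| \<le>o |S|"
    using free_extension_exists[OF infU V L b(2,1) infS S(3)] .
  have NK: "N \<in> K"
    using N(1) infK range_inj_infinite[OF b(1)] unfolding free_algs_inf_def by auto
  have "|carrier N| \<le>o \<kappa>"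
    using ordLess_imp_ordLeq[OF ordLeq_ordLess_trans[OF N(5) \<kappa>]] .
  moreover have "universal_model L K le \<kappa> M"
    using M by (simp add: monster_def)
  ultimately obtain f where f: "embedding L N M f" "le (induced L M (f ` carrier N)) M"
    using NK unfolding universal_model_def strong_embedding_def by blast
  note fiso = embedding_iso_image[OF f(1)]
  \<comment> \<open>The model is replaced by an isomorphic copy containing \<open>N\<close>, since the hypotheses on \<open>A\<close> and
    \<open>B\<close> concern inclusions rather than embeddings.\<close>
  have "inj_on (inv_into (carrier N) f) (f ` carrier N)"
    by (rule inj_on_inv_into) simp
  then obtain M' k where k: "iso L M M' k" "\<And>x. x \<in> f ` carrier N \<Longrightarrow> k x = inv_into (carrier N) f x"
    using iso_extension[OF infU substructureD(2)[OF fiso(1)], of "f ` carrier N"] substructureD(3)[OF fiso(1)]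
    by (metis carrier_induced)
  have "iso L (induced L M (f ` carrier N)) N k"
    using iso_inv_into[OF fiso(2)] by (rule iso_cong) (simp add: k(2))
  then have leN: "le N M'"
    using AEC_D(5)[OF AEC f(2) k(1)] by blast
  have M': "monster L K le \<kappa> M'"
    using AEC M k(1) by (rule monster_iso)
  \<comment> \<open>The nodes of length one already suffice.\<close>
  have SZ: "|S| \<le>o |\<beta> ` lists S|"
  proof -
    have "inj_on (\<lambda>x. \<beta> [x]) S"
      by (rule inj_onI) (use inj_onD[OF N(2)] in fastforce)
    moreover have "(\<lambda>x. \<beta> [x]) ` S \<subseteq> \<beta> ` lists S"
      by auto
    ultimately show ?thesis
      using card_of_ordLeq by blast
  qed
  interpret RCP_in_monster L V K le A B b0 a N M' \<kappa> "range b" "\<beta> ` lists S"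
  proof
    show "uncountable (\<beta> ` lists S)"
    proof
      assume "countable (\<beta> ` lists S)"
      moreover obtain j where "inj_on j S" "j ` S \<subseteq> \<beta> ` lists S"
        using SZ unfolding card_of_ordLeq[symmetric] by blast
      ultimately show False
        using S(4) by (metis countable_image_inj_on countable_subset)
    qed
    show "|carrier N| <o \<kappa>"
      using N(5) \<kappa> by (rule ordLeq_ordLess_trans)
  qed (fact nat V cov strong witness a N range_inj_infinite[OF b(1)] M' leN)+
  obtain c :: "(nat \<Rightarrow> 'u) \<Rightarrow> 'u" where c: "\<And>\<eta> \<nu>. range \<eta> \<subseteq> S \<Longrightarrow> range \<nu> \<subseteq> S \<Longrightarrow> \<eta> \<noteq> \<nu> \<Longrightarrow>
    c \<eta> \<in> carrier M' \<and> (\<forall>h. automorphism L M' h \<and> (\<forall>x \<in> carrier N0. h x = x) \<longrightarrow> h (c \<eta>) \<noteq> c \<nu>)"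
    using many_types[OF N(2) order_refl] by blast
  \<comment> \<open>The bound on types is known for \<open>M\<close> and not for its copy, so
    \<open>N0\<close> is pulled back along \<open>k\<close>.\<close>
  obtain P where P: "le P M" "iso L P N0 k"
    using strong_pullback[OF AEC k(1) le_N0M] .
  have PM: "carrier P \<subseteq> carrier M"
    using substructureD(3)[OF AEC_D(6)[OF AEC P(1)]] .
  have "|carrier N0| \<le>o |S|"
    using card_of_mono1[OF substructureD(3)[OF sub_N0N]] N(5) ordLeq_transitive by blast
  moreover have "|S| \<le>o |carrier N0|"
    using SZ card_of_mono1[OF Z_in_N0] ordLeq_transitive by blast
  ultimately have "|carrier P| =o |S|"
    using iso_card_of[OF P(2)] ordIso_iff_ordLeq ordIso_transitive by blast
  then have bound: "|galois_types L M (carrier P)| \<le>o |S|"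
    using types P(1) by blast
  let ?k = "inv_into (carrier M) k"
  let ?t = "\<lambda>\<eta>. galois_type L M (carrier P) (?k (c \<eta>))"
  \<comment> \<open>Equal types give an automorphism of \<open>M\<close> over \<open>P\<close>;
    conjugated by \<open>k\<close> it fixes \<open>N0\<close> and sends \<open>c \<eta>\<close> to
    \<open>c \<nu>\<close>, which \<open>c\<close> excludes.\<close>
  have "inj_on ?t {\<eta>. range \<eta> \<subseteq> S}"
  proof (intro inj_onI CollectI, elim CollectE, rule ccontr)
    fix \<eta> \<nu> assume *: "range \<eta> \<subseteq> S" "range \<nu> \<subseteq> S" "?t \<eta> = ?t \<nu>" "\<eta> \<noteq> \<nu>"
    have sM: "is_structure L M"
      using AEC_D(2,3)[OF AEC] P(1) by blast
    have "automorphism L M id"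
      using hom_inclusion[OF substructure_refl[OF sM]] by (simp add: iso_def)
    then have "?k (c \<nu>) \<in> ?t \<nu>"
      unfolding galois_type_def by (intro CollectI exI[of _ id]) simp
    then have "?k (c \<nu>) \<in> ?t \<eta>"
      using *(3) by simp
    then obtain g where g: "automorphism L M g" "\<forall>x \<in> carrier P. g x = x" "?k (c \<nu>) = g (?k (c \<eta>))"
      unfolding galois_type_def by auto
    obtain g' where g': "automorphism L M' g'" "\<And>x. x \<in> carrier M \<Longrightarrow> g' (k x) = k (g x)"
      using automorphism_conjugate[OF k(1) g(1)] by blast
    have "g' x = x" if "x \<in> carrier N0" for x
    proof -
      obtain y where "y \<in> carrier P" "x = k y"
        using \<open>x \<in> carrier N0\<close> isoD(4)[OF P(2)] by auto
      then show ?thesis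
        using g'(2)[of y] g(2) PM by auto
    qed
    moreover have "g' (c \<eta>) = c \<nu>"
    proof -
      have cM: "c \<eta> \<in> k ` carrier M" "c \<nu> \<in> k ` carrier M"
        using c[OF *(1,2,4)] c[OF *(2,1)] *(4) isoD(4)[OF k(1)] by auto
      then have "g' (k (?k (c \<eta>))) = k (g (?k (c \<eta>)))"
        by (intro g'(2) inv_into_into)
      then show ?thesis
        using g(3) cM by (metis f_inv_into_f)
    qed
    ultimately show False
      using c[OF *(1,2,4)] g'(1) by blast
  qed
  moreover have "?t ` {\<eta>. range \<eta> \<subseteq> S} \<subseteq> galois_types L M (carrier P)"
  proof (intro image_subsetI, elim CollectE)
    fix \<eta> :: "nat \<Rightarrow> 'u" assume \<eta>: "range \<eta> \<subseteq> S"
    \<comment> \<open>The property of \<open>c\<close> speaks only of pairs of distinct sequences,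
      so a constant sequence differing from \<open>\<eta>\<close> at \<open>0\<close> is supplied as
      the partner.\<close>
    obtain s where "s \<in> S" "s \<noteq> \<eta> 0"
      using infinite_imp_nonempty[OF infinite_remove[OF infS, of "\<eta> 0"]] by blast
    then have "range (\<lambda>_ :: nat. s) \<subseteq> S" "\<eta> \<noteq> (\<lambda>_. s)"
      by auto
    then have "c \<eta> \<in> carrier M'"
      using c[OF \<eta>] by blast
    then have "?k (c \<eta>) \<in> carrier M"
      using isoD(4)[OF k(1)] by (intro inv_into_into) simp
    then show "?t \<eta> \<in> galois_types L M (carrier P)"
      by (simp add: galois_types_def)
  qed
  ultimately have "|{\<eta> :: nat \<Rightarrow> 'u. range \<eta> \<subseteq> S}| \<le>o |galois_types L M (carrier P)|"
    using card_of_ordLeq by blast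
  then have "|{\<eta> :: nat \<Rightarrow> 'u. range \<eta> \<subseteq> S}| \<le>o |S|"
    using bound ordLeq_transitive by blast
  then show False
    using koenig_sequences[OF S(1,2)] by blast
qed

end
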